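(* Let $\mathsf{P}$ be the (separable) Prüfer surface and $Z=\bigcup_{c\in\mathbb{R}}\{0_c\}$, where $0_c$ denotes the $0$-point of the boundary component $\mathbb{R}_c$. Then $\mathsf{P}-Z$ is a non-contractible (and hence not homotopy equivalent to a CW-complex) non-metrizable submanifold of the manifold $\mathsf{P}$, which is contractible.
   Context: The Prüfer surface $\mathsf{P}$ is a surface with boundary defined as follows. Let $H_0=\{\langle x,y\rangle\in\mathbb{R}^2: x>0\}$, and for each $c\in\mathbb{R}$ let $\mathbb{R}_c$ be a copy of $\mathbb{R}$; for $E\subset\mathbb{R}$ write $E_c$ for the copy of $E$ in $\mathbb{R}_c$. As a set, $\mathsf{P}$ is the disjoint union $H_0\cup\bigcup_{c\in\mathbb{R}}\mathbb{R}_c$. Points of $H_0$ have their usual Euclidean neighborhoods (with $H_0$ open in $\mathsf{P}$), and a neighborhood basis of $u\in\mathbb{R}_c$ is given by the sets $$T^c_{a,b,\epsilon}=(a,b)_c\cup\{\langle x,y\rangle\in H_0: ax+c<y<bx+c,\ x<\epsilon\}$$ for $a<u<b$ and $\epsilon>0$. The boundary of $\mathsf{P}$ is $\bigcup_{c\in\mathbb{R}}\mathbb{R}_c$. The words "submanifold" and "manifold" here allow a boundary: a manifold with boundary is a connected Hausdorff space each of whose points has a neighborhood homeomorphic to $\mathbb{R}^{n-1}\times\mathbb{R}_{\ge 0}$, or (for interior points) to $\mathbb{R}^n$, for some finite $n>0$. *)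

theory Defs
  imports "HOL-Analysis.Analysis"
begin

section \<open>The Pruefer surface\<close>

definition half_plane :: "(real \<times> real) set" where
  "half_plane = {(x, y). x > 0}"

text \<open>The underlying set is a disjoint union, formed in a sum type: \<open>Inl (x, y)\<close> is the point
  \<open>(x, y)\<close> of the open half plane, and \<open>Inr (c, u)\<close> is the point \<open>u\<close> of the copy of
  the real line with index \<open>c\<close>.\<close>

type_synonym pruefer_point = "(real \<times> real) + (real \<times> real)"

definition pruefer_set :: "pruefer_point set" where
  "pruefer_set = half_plane <+> UNIV"

definition pruefer_nbhd :: "real \<Rightarrow> real \<Rightarrow> real \<Rightarrow> real \<Rightarrow> pruefer_point set" where
  "pruefer_nbhd c a b \<epsilon> =
     {Inr (c, u) | u. a < u \<and> u < b} \<union>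
     {Inl (x, y) | x y. (x, y) \<in> half_plane \<and> a * x + c < y \<and> y < b * x + c \<and> x < \<epsilon>}"

definition pruefer_open :: "pruefer_point set \<Rightarrow> bool" where
  "pruefer_open U \<longleftrightarrow>
     U \<subseteq> pruefer_set \<and>
     (\<forall>p. Inl p \<in> U \<longrightarrow> (\<exists>V. open V \<and> p \<in> V \<and> V \<subseteq> half_plane \<and> Inl ` V \<subseteq> U)) \<and>
     (\<forall>c u. Inr (c, u) \<in> U \<longrightarrow>
        (\<exists>a b \<epsilon>. a < u \<and> u < b \<and> 0 < \<epsilon> \<and> pruefer_nbhd c a b \<epsilon> \<subseteq> U))"

definition pruefer :: "pruefer_point topology" where
  "pruefer = topology pruefer_open"

definition pruefer_zeros :: "pruefer_point set" where
  "pruefer_zeros = (\<Union>c. {Inr (c, 0)})"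

lemma pruefer_nbhd_mono:
  assumes "a \<le> a'" "b' \<le> b" "\<epsilon>' \<le> \<epsilon>"
  shows "pruefer_nbhd c a' b' \<epsilon>' \<subseteq> pruefer_nbhd c a b \<epsilon>"
proof -
  have "a * x \<le> a' * x" "b' * x \<le> b * x" if "x > 0" for x
    using assms that by (simp_all add: mult_right_mono)
  then show ?thesis
    using assms unfolding pruefer_nbhd_def half_plane_def by fastforce
qed

lemma istopology_pruefer_open: "istopology pruefer_open"
  unfolding istopology_def
proof (intro conjI allI impI)
  fix S T assume S: "pruefer_open S" and T: "pruefer_open T"
  show "pruefer_open (S \<inter> T)"
    unfolding pruefer_open_def
  proof (intro conjI allI impI)
    show "S \<inter> T \<subseteq> pruefer_set"
      using S by (auto simp: pruefer_open_def)
  next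
    fix p :: "real \<times> real" assume p: "Inl p \<in> S \<inter> T"
    obtain V where "open V" "p \<in> V" "V \<subseteq> half_plane" "Inl ` V \<subseteq> S"
      using S p unfolding pruefer_open_def by blast
    moreover obtain W where "open W" "p \<in> W" "W \<subseteq> half_plane" "Inl ` W \<subseteq> T"
      using T p unfolding pruefer_open_def by blast
    ultimately show "\<exists>V. open V \<and> p \<in> V \<and> V \<subseteq> half_plane \<and> Inl ` V \<subseteq> S \<inter> T"
      by (intro exI[of _ "V \<inter> W"]) auto
  next
    fix c u :: real assume u: "Inr (c, u) \<in> S \<inter> T"
    obtain a b e where 1: "a < u" "u < b" "0 < e" "pruefer_nbhd c a b e \<subseteq> S"
      using S u unfolding pruefer_open_def by blast
    obtain a' b' e' where 2: "a' < u" "u < b'" "0 < e'" "pruefer_nbhd c a' b' e' \<subseteq> T"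
      using T u unfolding pruefer_open_def by blast
    have "pruefer_nbhd c (max a a') (min b b') (min e e') \<subseteq> S \<inter> T"
      using 1(4) 2(4) pruefer_nbhd_mono[of a "max a a'" "min b b'" b "min e e'" e c]
        pruefer_nbhd_mono[of a' "max a a'" "min b b'" b' "min e e'" e' c] by auto
    then show "\<exists>a b \<epsilon>. a < u \<and> u < b \<and> 0 < \<epsilon> \<and> pruefer_nbhd c a b \<epsilon> \<subseteq> S \<inter> T"
      using 1 2 by (intro exI[of _ "max a a'"] exI[of _ "min b b'"] exI[of _ "min e e'"]) auto
  qed
next
  fix \<K> assume "\<forall>K\<in>\<K>. pruefer_open K"
  then show "pruefer_open (\<Union>\<K>)"
    unfolding pruefer_open_def
    by (intro conjI allI impI; (elim UnionE)?; meson Sup_least Union_upper order_trans)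
qed

lemma openin_pruefer: "openin pruefer U \<longleftrightarrow> pruefer_open U"
  by (simp add: pruefer_def topology_inverse' istopology_pruefer_open)

lemma open_half_plane: "open half_plane"
proof -
  have "half_plane = {0<..} \<times> UNIV" by (auto simp: half_plane_def)
  then show ?thesis by (metis open_Times open_greaterThan open_UNIV)
qed

lemma openin_pruefer_nbhd:
  assumes "0 < \<epsilon>"
  shows "openin pruefer (pruefer_nbhd c a b \<epsilon>)"
  unfolding openin_pruefer pruefer_open_def
proof (intro conjI allI impI)
  show "pruefer_nbhd c a b \<epsilon> \<subseteq> pruefer_set"
    by (auto simp: pruefer_nbhd_def pruefer_set_def)
next
  fix p :: "real \<times> real" assume p: "Inl p \<in> pruefer_nbhd c a b \<epsilon>"
  let ?V = "half_plane \<inter> {q. a * fst q + c < snd q} \<inter> {q. snd q < b * fst q + c} \<inter> {q. fst q < \<epsilon>}"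
  have "open ?V"
    by (intro open_Int open_half_plane open_Collect_less continuous_intros)
  then show "\<exists>V. open V \<and> p \<in> V \<and> V \<subseteq> half_plane \<and> Inl ` V \<subseteq> pruefer_nbhd c a b \<epsilon>"
    using p by (intro exI[of _ ?V]) (auto simp: pruefer_nbhd_def)
next
  fix d u assume "Inr (d, u) \<in> pruefer_nbhd c a b \<epsilon>"
  then have u: "d = c" "a < u" "u < b" by (auto simp: pruefer_nbhd_def)
  with assms show "\<exists>a' b' \<epsilon>'. a' < u \<and> u < b' \<and> 0 < \<epsilon>' \<and> pruefer_nbhd d a' b' \<epsilon>' \<subseteq> pruefer_nbhd c a b \<epsilon>"
    by blast
qed

lemma topspace_pruefer: "topspace pruefer = pruefer_set"
proof -
  have "pruefer_open pruefer_set"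
    unfolding pruefer_open_def
  proof (intro conjI allI impI)
    fix p :: "real \<times> real" assume "Inl p \<in> pruefer_set"
    then show "\<exists>V. open V \<and> p \<in> V \<and> V \<subseteq> half_plane \<and> Inl ` V \<subseteq> pruefer_set"
      using open_half_plane by (intro exI[of _ half_plane]) (auto simp: pruefer_set_def)
  next
    fix c u :: real
    show "\<exists>a b \<epsilon>. a < u \<and> u < b \<and> 0 < \<epsilon> \<and> pruefer_nbhd c a b \<epsilon> \<subseteq> pruefer_set"
      by (intro exI[of _ "u - 1"] exI[of _ "u + 1"] exI[of _ "1::real"])
         (auto simp: pruefer_nbhd_def pruefer_set_def)
  qed auto
  then show ?thesis
    by (metis openin_pruefer openin_subset openin_topspace pruefer_open_def subset_antisym)
qed

section \<open>Manifolds with boundary\<close>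

definition manifold_with_boundary :: "nat \<Rightarrow> 'a topology \<Rightarrow> bool" where
  "manifold_with_boundary n X \<longleftrightarrow>
     n > 0 \<and> connected_space X \<and> Hausdorff_space X \<and>
     (\<forall>x\<in>topspace X. \<exists>U. openin X U \<and> x \<in> U \<and>
        (subtopology X U homeomorphic_space Euclidean_space n \<or>
         subtopology X U homeomorphic_space
           prod_topology (Euclidean_space (n - 1)) (top_of_set {0::real..})))"

definition submanifold :: "'a topology \<Rightarrow> 'a set \<Rightarrow> bool" where
  "submanifold X S \<longleftrightarrow>
     S \<subseteq> topspace X \<and> (\<exists>k. manifold_with_boundary k (subtopology X S))"

section \<open>CW complexes\<close>

text \<open>Whitehead's definition of a (not necessarily finite) CW complex. The sphere below is the
  unit sphere of dimension \<open>n - 1\<close>, so it is empty for \<open>n = 0\<close>.\<close>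

definition unit_disc :: "nat \<Rightarrow> (nat \<Rightarrow> real) topology" where
  "unit_disc n = subtopology (Euclidean_space n) {x. (\<Sum>i<n. (x i)\<^sup>2) \<le> 1}"

definition open_unit_disc :: "nat \<Rightarrow> (nat \<Rightarrow> real) topology" where
  "open_unit_disc n = subtopology (Euclidean_space n) {x. (\<Sum>i<n. (x i)\<^sup>2) < 1}"

definition unit_disc_sphere :: "nat \<Rightarrow> (nat \<Rightarrow> real) set" where
  "unit_disc_sphere n = {x \<in> topspace (Euclidean_space n). (\<Sum>i<n. (x i)\<^sup>2) = 1}"

text \<open>\<open>E\<close> is the set of open cells, \<open>d e\<close> the dimension and \<open>\<Phi> e\<close> a characteristic map of
  the cell \<open>e\<close>. The last two conditions are closure finiteness and the weak topology.\<close>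

definition cell_decomposition ::
    "'a topology \<Rightarrow> 'a set set \<Rightarrow> ('a set \<Rightarrow> nat) \<Rightarrow> ('a set \<Rightarrow> (nat \<Rightarrow> real) \<Rightarrow> 'a) \<Rightarrow> bool" where
  "cell_decomposition X E d \<Phi> \<longleftrightarrow>
     \<Union>E = topspace X \<and> pairwise disjnt E \<and>
     (\<forall>e\<in>E. continuous_map (unit_disc (d e)) X (\<Phi> e) \<and>
        homeomorphic_map (open_unit_disc (d e)) (subtopology X e) (\<Phi> e) \<and>
        (\<exists>F. finite F \<and> F \<subseteq> {f \<in> E. d f < d e} \<and> \<Phi> e ` unit_disc_sphere (d e) \<subseteq> \<Union>F)) \<and>
     (\<forall>A \<subseteq> topspace X. (\<forall>e\<in>E. closedin X (A \<inter> X closure_of e)) \<longrightarrow> closedin X A)"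

definition CW_complex :: "'a topology \<Rightarrow> bool" where
  "CW_complex X \<longleftrightarrow> Hausdorff_space X \<and> (\<exists>E d \<Phi>. cell_decomposition X E d \<Phi>)"

end

theory Submission
  imports Defs
begin

text \<open>Near the boundary line with index \<open>c\<close> the surface has the coordinates \<open>(u, x)\<close>, where
\<open>u = (y - c) / x\<close> is the slope at which \<open>(x, y)\<close> is seen from \<open>(0, c)\<close>; the boundary point
\<open>u\<close> of the line is \<open>(u, 0)\<close>. In these coordinates the open half plane together with one boundary
line is a closed half plane, which gives the manifold structure. Continuity of maps on
the surface is checked in these charts, one line at a time.

The surface is contractible. A motion \<open>(x, y) \<mapsto> (X, y)\<close> of the half plane, where \<open>X\<close> depends
on \<open>x\<close> and on time only, multiplies the slopes seen from every point \<open>(0, c)\<close> by the same factor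
\<open>x / X\<close>. If this factor tends to \<open>1 - t\<close> for \<open>x \<rightarrow> 0\<close>, then all boundary lines are contracted
linearly and simultaneously, each to its zero point (\<open>id_homotopic_flatten\<close>). After that the
horizontal motion \<open>(x, y) \<mapsto> (x + s, y)\<close> carries everything into the half plane
(\<open>flatten_homotopic_push_inside\<close>), which is convex.

The punctured surface lacks the points to which the lines were collapsed. In fact a homotopy that
starts at the identity leaves the point \<open>1\<close> of all but countably many lines on its own line
(\<open>homotopic_id_leaves_countably_many_lines\<close>): the points \<open>1\<close> and \<open>-1\<close> of a line \<open>c\<close> lie on
different components of the punctured line, and as long as they stay on the boundary they keep their
sides. Just after the first of them, say \<open>1\<close>, enters the half plane, it lies above the height \<open>c\<close>
while the other one is still on the lower side. If this happened for uncountably many \<open>c\<close>, it would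
happen for uncountably many of them at one rational time and with one modulus of continuity. Some
point of the half plane is then close both to the point \<open>1\<close> of a line \<open>c\<^sub>0\<close> and to the point
\<open>-1\<close> of a line \<open>c\<close> slightly above it. Its image has to lie above a height that exceeds \<open>c\<^sub>0\<close> by
a fixed amount, and also below \<open>c\<close>, which is impossible for \<open>c\<close> near \<open>c\<^sub>0\<close>
(\<open>countable_separated_pairs\<close>).

A compact set meets only finitely many boundary lines. Hence the identity is not homotopic to any map
into a countable union of compact sets (\<open>id_not_homotopic_into_sigma_compact\<close>). A constant map is of
this kind, so the punctured surface is not contractible. A map that factors through a CW
complex \<open>Y\<close> is of this kind as well: the punctured surface is separable, and the closure of a countable
subset of \<open>Y\<close> lies in a countable union of compact sets, namely of closed cells
(\<open>CW_closure_of_countable\<close>). So the punctured surface is not even dominated by a CW complex.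

Finally, in a separable metric space an uncountable set of points cannot be discrete, whereas the
points \<open>1\<close> of the boundary lines form a discrete set (\<open>not_metrizable_punctured\<close>).\<close>

section \<open>Points and open sets\<close>

lemma Inl_in_pruefer_set: "Inl (x, y) \<in> pruefer_set \<longleftrightarrow> x > 0"
  by (auto simp: pruefer_set_def half_plane_def)

lemma Inr_in_pruefer_set [simp]: "Inr q \<in> pruefer_set"
  by (auto simp: pruefer_set_def)

lemma in_pruefer_nbhd:
  "Inr (d, u) \<in> pruefer_nbhd c a b e \<longleftrightarrow> d = c \<and> a < u \<and> u < b"
  "Inl (x, y) \<in> pruefer_nbhd c a b e \<longleftrightarrow> 0 < x \<and> a * x + c < y \<and> y < b * x + c \<and> x < e"
  by (auto simp: pruefer_nbhd_def half_plane_def)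

lemma openin_pruefer_boundary_point:
  assumes "openin pruefer S" "Inr (c, u) \<in> S"
  obtains e where "0 < e" "pruefer_nbhd c (u - e) (u + e) e \<subseteq> S"
proof -
  obtain a b e where "a < u" "u < b" "0 < e" "pruefer_nbhd c a b e \<subseteq> S"
    using assms unfolding openin_pruefer pruefer_open_def by meson
  moreover define r where "r = min e (min (u - a) (b - u))"
  moreover have "r \<le> e" "a \<le> u - r" "u + r \<le> b"
    by (auto simp: r_def)
  ultimately show thesis
    using pruefer_nbhd_mono[of a "u - r" "u + r" b r e c] that[of r] by auto
qed

text \<open>Sets of this form are open as soon as their trace on each line is open, since the lines have no
influence on each other. They serve to see that removing closed pieces of the lines leaves an open set.\<close>

definition half_plane_with_boundary :: "(real \<times> real) set \<Rightarrow> pruefer_point set" where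
  "half_plane_with_boundary B = Inl ` half_plane \<union> Inr ` B"

lemma openin_half_plane_with_boundary:
  assumes "\<And>c. open {u. (c, u) \<in> B}"
  shows "openin pruefer (half_plane_with_boundary B)"
  unfolding openin_pruefer pruefer_open_def
proof (intro conjI allI impI)
  show "half_plane_with_boundary B \<subseteq> pruefer_set"
    by (auto simp: half_plane_with_boundary_def pruefer_set_def)
next
  fix p :: "real \<times> real"
  assume "Inl p \<in> half_plane_with_boundary B"
  then show "\<exists>V. open V \<and> p \<in> V \<and> V \<subseteq> half_plane \<and> Inl ` V \<subseteq> half_plane_with_boundary B"
    using open_half_plane by (intro exI[of _ half_plane]) (auto simp: half_plane_with_boundary_def)
next
  fix c u
  assume "Inr (c, u) \<in> half_plane_with_boundary B"
  then have "u \<in> {u. (c, u) \<in> B}"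
    by (auto simp: half_plane_with_boundary_def)
  then obtain e where "0 < e" "ball u e \<subseteq> {u. (c, u) \<in> B}"
    using assms open_contains_ball by blast
  then have "pruefer_nbhd c (u - e) (u + e) e \<subseteq> half_plane_with_boundary B"
    by (force simp: pruefer_nbhd_def half_plane_with_boundary_def dist_real_def)
  then show "\<exists>a b \<epsilon>. a < u \<and> u < b \<and> 0 < \<epsilon> \<and> pruefer_nbhd c a b \<epsilon> \<subseteq> half_plane_with_boundary B"
    using \<open>0 < e\<close> by (intro exI[of _ "u - e"] exI[of _ "u + e"] exI[of _ e]) auto
qed

section \<open>Slope coordinates near a boundary line\<close>

text \<open>The parametrization of the half plane and the line with index \<open>c\<close> by slope and abscissa. It is meant
for \<open>x \<ge> 0\<close> only; the domain of all its uses is \<open>UNIV \<times> {0..}\<close> or a subset of it.\<close>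

definition chart :: "real \<Rightarrow> real \<times> real \<Rightarrow> pruefer_point" where
  "chart c = (\<lambda>(u, x). if x > 0 then Inl (x, c + u * x) else Inr (c, u))"

definition slope_coords :: "real \<Rightarrow> pruefer_point \<Rightarrow> real \<times> real" where
  "slope_coords c p = (case p of Inl (x, y) \<Rightarrow> ((y - c) / x, x) | Inr (d, u) \<Rightarrow> (u, 0))"

lemma slope_coords_chart: "x \<ge> 0 \<Longrightarrow> slope_coords c (chart c (u, x)) = (u, x)"
  by (auto simp: slope_coords_def chart_def)

lemma chart_slope_coords:
  assumes "p \<in> chart c ` (UNIV \<times> {0..})"
  shows "slope_coords c p \<in> UNIV \<times> {0..}" "chart c (slope_coords c p) = p"
  using assms by (auto simp: slope_coords_chart)

lemma in_chart_image:
  "Inr (d, u) \<in> chart c ` (J \<times> {0..}) \<longleftrightarrow> d = c \<and> u \<in> J"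
  "Inl (x, y) \<in> chart c ` (J \<times> {0..}) \<longleftrightarrow> 0 < x \<and> (y - c) / x \<in> J"
proof -
  show "Inr (d, u) \<in> chart c ` (J \<times> {0..}) \<longleftrightarrow> d = c \<and> u \<in> J"
    by (auto simp: chart_def image_iff split: if_splits intro!: bexI[of _ "(u, 0)"])
  show "Inl (x, y) \<in> chart c ` (J \<times> {0..}) \<longleftrightarrow> 0 < x \<and> (y - c) / x \<in> J"
  proof
    assume "Inl (x, y) \<in> chart c ` (J \<times> {0..})"
    then show "0 < x \<and> (y - c) / x \<in> J"
      by (auto simp: chart_def split: if_splits)
  next
    assume "0 < x \<and> (y - c) / x \<in> J"
    then have "Inl (x, y) = chart c ((y - c) / x, x)" "((y - c) / x, x) \<in> J \<times> {0..}"
      by (simp_all add: chart_def)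
    then show "Inl (x, y) \<in> chart c ` (J \<times> {0..})"
      by (metis image_eqI)
  qed
qed

lemma chart_in_pruefer_set [simp]: "chart c q \<in> pruefer_set"
  by (auto simp: chart_def pruefer_set_def half_plane_def split: prod.split)

lemma pruefer_set_charts: "p \<in> pruefer_set \<Longrightarrow> \<exists>c. p \<in> chart c ` (UNIV \<times> {0..})"
  by (cases p) (auto simp: in_chart_image Inl_in_pruefer_set)

text \<open>The basic neighbourhoods of the boundary points are exactly the images of boxes
\<open>{a<..<b} \<times> {0..<\<epsilon>}\<close>, so that the topology of the surface is the one that makes the charts
homeomorphisms onto open sets; this is the content of the lemmas up to \<open>homeomorphic_maps_chart\<close>.\<close>

lemma continuous_map_chart: "continuous_map (top_of_set (UNIV \<times> {0..})) pruefer (chart c)"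
  unfolding continuous_map_def
proof (intro conjI allI impI)
  show "chart c \<in> topspace (top_of_set (UNIV \<times> {0..})) \<rightarrow> topspace pruefer"
    by (simp add: topspace_pruefer)
next
  fix S
  assume S: "openin pruefer S"
  have nbhd: "\<exists>T. open T \<and> q \<in> T \<and> UNIV \<times> {0..} \<inter> T \<subseteq> {q \<in> UNIV \<times> {0..}. chart c q \<in> S}"
    if q: "q \<in> UNIV \<times> {0..}" "chart c q \<in> S" for q
  proof -
    obtain u x where [simp]: "q = (u, x)"
      by (cases q)
    show ?thesis
    proof (cases "x > 0")
      case True
      with q have "Inl (x, c + u * x) \<in> S"
        by (simp add: chart_def)
      then obtain V where V: "open V" "(x, c + u * x) \<in> V" "Inl ` V \<subseteq> S" "V \<subseteq> half_plane"
        using S unfolding openin_pruefer pruefer_open_def by meson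
      have "open ((\<lambda>q. (snd q, c + fst q * snd q)) -` V)"
        by (rule open_vimage[OF V(1)]) (intro continuous_intros)
      moreover have "chart c (v, z) \<in> S" if "(z, c + v * z) \<in> V" for v z
        using that V by (auto simp: chart_def half_plane_def)
      ultimately show ?thesis
        using V by (intro exI[of _ "(\<lambda>q. (snd q, c + fst q * snd q)) -` V"]) auto
    next
      case False
      with q have "Inr (c, u) \<in> S"
        by (simp add: chart_def)
      then obtain e where e: "0 < e" "pruefer_nbhd c (u - e) (u + e) e \<subseteq> S"
        using S openin_pruefer_boundary_point by metis
      have "chart c (v, z) \<in> pruefer_nbhd c (u - e) (u + e) e"
        if "u - e < v" "v < u + e" "z < e" for v z
        using that by (auto simp: chart_def in_pruefer_nbhd)
      then show ?thesis
        using q False e by (intro exI[of _ "{u - e<..<u + e} \<times> {..<e}"]) (auto intro: open_Times)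
    qed
  qed
  show "openin (top_of_set (UNIV \<times> {0..})) {q \<in> topspace (top_of_set (UNIV \<times> {0..})). chart c q \<in> S}"
  proof (subst openin_subopen, intro ballI)
    fix q
    assume q: "q \<in> {q \<in> topspace (top_of_set (UNIV \<times> {0..})). chart c q \<in> S}"
    with nbhd[of q] obtain T where "open T" "q \<in> T" "UNIV \<times> {0..} \<inter> T \<subseteq> {q \<in> UNIV \<times> {0..}. chart c q \<in> S}"
      by auto
    with q show "\<exists>T. openin (top_of_set (UNIV \<times> {0..})) T \<and> q \<in> T \<and>
        T \<subseteq> {q \<in> topspace (top_of_set (UNIV \<times> {0..})). chart c q \<in> S}"
      by (intro exI[of _ "UNIV \<times> {0..} \<inter> T"]) (auto simp: openin_open_Int)
  qed
qed

lemma openin_chart_image: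
  assumes "open V"
  shows "openin pruefer (chart c ` (V \<inter> UNIV \<times> {0..}))"
  unfolding openin_pruefer pruefer_open_def
proof (intro conjI allI impI)
  show "chart c ` (V \<inter> UNIV \<times> {0..}) \<subseteq> pruefer_set"
    by auto
next
  fix p :: "real \<times> real"
  assume p: "Inl p \<in> chart c ` (V \<inter> UNIV \<times> {0..})"
  let ?f = "\<lambda>q::real \<times> real. ((snd q - c) / fst q, fst q)"
  have "continuous_on half_plane ?f"
    by (intro continuous_intros) (auto simp: half_plane_def)
  then have "open (half_plane \<inter> ?f -` V)"
    using assms open_half_plane continuous_on_open_vimage[of half_plane ?f] by (simp add: Int_commute)
  moreover have "p \<in> half_plane \<inter> ?f -` V"
    using p by (auto simp: chart_def half_plane_def split: if_splits)
  moreover have "Inl (x, y) \<in> chart c ` (V \<inter> UNIV \<times> {0..})" if "(x, y) \<in> half_plane \<inter> ?f -` V" for x y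
    using that by (auto simp: image_iff chart_def half_plane_def intro!: bexI[of _ "((y - c) / x, x)"])
  ultimately show "\<exists>V'. open V' \<and> p \<in> V' \<and> V' \<subseteq> half_plane \<and> Inl ` V' \<subseteq> chart c ` (V \<inter> UNIV \<times> {0..})"
    by (intro exI[of _ "half_plane \<inter> ?f -` V"]) auto
next
  fix d u
  assume "Inr (d, u) \<in> chart c ` (V \<inter> UNIV \<times> {0..})"
  then have [simp]: "d = c" and "(u, 0) \<in> V"
    by (auto simp: chart_def split: if_splits)
  then obtain A B where AB: "open A" "open B" "u \<in> A" "0 \<in> B" "A \<times> B \<subseteq> V"
    using assms open_prod_elim by (metis mem_Sigma_iff)
  obtain r s where rs: "0 < r" "0 < s" "ball u r \<subseteq> A" "ball 0 s \<subseteq> B"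
    using AB by (meson open_contains_ball)
  have "chart c (v, x) \<in> chart c ` (V \<inter> UNIV \<times> {0..})" if "u - r < v" "v < u + r" "0 \<le> x" "x < s" for v x
    using that rs AB by (intro imageI) (auto simp: ball_def dist_real_def subset_iff)
  moreover have "\<exists>v x. q = chart c (v, x) \<and> u - r < v \<and> v < u + r \<and> 0 \<le> x \<and> x < s"
    if q: "q \<in> pruefer_nbhd c (u - r) (u + r) s" for q
  proof (cases q)
    case (Inl p)
    obtain x y where [simp]: "p = (x, y)"
      by (cases p)
    have *: "0 < x" "(u - r) * x + c < y" "y < (u + r) * x + c" "x < s"
      using q Inl by (auto simp: in_pruefer_nbhd)
    then have "q = chart c ((y - c) / x, x)" "u - r < (y - c) / x" "(y - c) / x < u + r"
      by (auto simp: chart_def Inl field_simps)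
    then show ?thesis
      using * by (metis less_eq_real_def)
  next
    case (Inr p)
    then obtain v where "q = Inr (c, v)" "u - r < v" "v < u + r"
      using q by (cases p) (auto simp: in_pruefer_nbhd)
    then show ?thesis
      using rs by (intro exI[of _ v] exI[of _ 0]) (auto simp: chart_def)
  qed
  ultimately have "pruefer_nbhd d (u - r) (u + r) s \<subseteq> chart c ` (V \<inter> UNIV \<times> {0..})"
    unfolding \<open>d = c\<close> by blast
  then show "\<exists>a b \<epsilon>. a < u \<and> u < b \<and> 0 < \<epsilon> \<and> pruefer_nbhd d a b \<epsilon> \<subseteq> chart c ` (V \<inter> UNIV \<times> {0..})"
    using rs by (intro exI[of _ "u - r"] exI[of _ "u + r"] exI[of _ s] conjI) simp_all
qed

lemma openin_chart_Times:
  assumes "open J"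
  shows "openin pruefer (chart c ` (J \<times> {0..}))"
proof -
  have "J \<times> {0..} = (J \<times> UNIV) \<inter> UNIV \<times> {0::real..}"
    by auto
  then show ?thesis
    by (metis assms open_Times open_UNIV openin_chart_image)
qed

lemma continuous_map_slope_coords:
  "continuous_map (subtopology pruefer (chart c ` (UNIV \<times> {0..}))) (top_of_set (UNIV \<times> {0..})) (slope_coords c)"
  unfolding continuous_map_def
proof (intro conjI allI impI)
  show "slope_coords c \<in> topspace (subtopology pruefer (chart c ` (UNIV \<times> {0..}))) \<rightarrow> topspace (top_of_set (UNIV \<times> {0..}))"
    using chart_slope_coords by (auto simp: topspace_pruefer)
next
  fix W
  assume "openin (top_of_set (UNIV \<times> {0..})) (W :: (real \<times> real) set)"
  then obtain V where V: "open V" "W = UNIV \<times> {0..} \<inter> V"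
    by (auto simp: openin_open)
  have "{p \<in> topspace (subtopology pruefer (chart c ` (UNIV \<times> {0..}))). slope_coords c p \<in> W}
      = chart c ` (V \<inter> UNIV \<times> {0..})"
    using V(2) chart_slope_coords by (auto simp: topspace_pruefer slope_coords_chart)
  then show "openin (subtopology pruefer (chart c ` (UNIV \<times> {0..})))
      {p \<in> topspace (subtopology pruefer (chart c ` (UNIV \<times> {0..}))). slope_coords c p \<in> W}"
    using openin_chart_image[OF V(1), of c] by (simp add: openin_open_subtopology openin_chart_Times) auto
qed

lemma homeomorphic_maps_chart:
  "homeomorphic_maps (top_of_set (J \<times> {0..})) (subtopology pruefer (chart c ` (J \<times> {0..})))
     (chart c) (slope_coords c)"
  unfolding homeomorphic_maps_def
proof (intro conjI ballI)
  have "continuous_map (top_of_set (J \<times> {0..})) pruefer (chart c)"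
    by (rule continuous_map_from_subtopology_mono[OF continuous_map_chart]) auto
  then show "continuous_map (top_of_set (J \<times> {0..})) (subtopology pruefer (chart c ` (J \<times> {0..}))) (chart c)"
    by (intro continuous_map_into_subtopology) auto
  have "continuous_map (subtopology pruefer (chart c ` (J \<times> {0..}))) (top_of_set (UNIV \<times> {0..})) (slope_coords c)"
    by (rule continuous_map_from_subtopology_mono[OF continuous_map_slope_coords]) auto
  then show "continuous_map (subtopology pruefer (chart c ` (J \<times> {0..}))) (top_of_set (J \<times> {0..})) (slope_coords c)"
    by (auto simp: continuous_map_in_subtopology slope_coords_chart topspace_pruefer)
qed (auto simp: slope_coords_chart topspace_pruefer)

text \<open>The images of the charts form an open cover of the surface, so continuity may be checked after
composition with them. The factor \<open>T\<close> is the time parameter of a homotopy.\<close>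

lemma continuous_map_from_prod_pruefer:
  assumes "\<And>c. continuous_map (prod_topology T (top_of_set (UNIV \<times> {0..}))) Y (\<lambda>(t, q). H (t, chart c q))"
  shows "continuous_map (prod_topology T pruefer) Y H"
proof (rule pasting_lemma[where I = UNIV and T = "\<lambda>c. topspace T \<times> chart c ` (UNIV \<times> {0..})" and f = "\<lambda>c. H"])
  fix c :: real
  let ?U = "chart c ` (UNIV \<times> {0..})"
  show "openin (prod_topology T pruefer) (topspace T \<times> ?U)"
    by (simp add: openin_prod_Times_iff openin_chart_Times)
  have "continuous_map (prod_topology T (subtopology pruefer ?U)) (prod_topology T (top_of_set (UNIV \<times> {0..})))
      (\<lambda>(t, p). (t, slope_coords c p))"
    using continuous_map_slope_coords[of c]
    by (simp add: continuous_map_prod_top)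
  from continuous_map_compose[OF this assms[of c]]
  have "continuous_map (prod_topology T (subtopology pruefer ?U)) Y H"
    by (rule continuous_map_eq) (use chart_slope_coords in \<open>force simp: topspace_pruefer\<close>)
  then show "continuous_map (subtopology (prod_topology T pruefer) (topspace T \<times> ?U)) Y H"
    by (simp flip: prod_topology_subtopology subtopology_Times)
next
  fix p assume "p \<in> topspace (prod_topology T pruefer)"
  then show "\<exists>c. c \<in> UNIV \<and> p \<in> topspace T \<times> chart c ` (UNIV \<times> {0..}) \<and> H p = H p"
    using pruefer_set_charts by (force simp: topspace_pruefer)
qed auto

section \<open>The punctured surface\<close>

abbreviation punctured_set :: "pruefer_point set" where
  "punctured_set \<equiv> topspace pruefer - pruefer_zeros"

abbreviation punctured :: "pruefer_point topology" where
  "punctured \<equiv> subtopology pruefer punctured_set"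

lemma punctured_set_eq: "punctured_set = half_plane_with_boundary {(c, u). u \<noteq> 0}"
  by (auto simp: topspace_pruefer pruefer_set_def pruefer_zeros_def half_plane_with_boundary_def)

lemma openin_punctured_set: "openin pruefer punctured_set"
proof -
  have "open {u::real. u \<noteq> 0}"
    by (simp add: open_Collect_neq)
  then show ?thesis
    unfolding punctured_set_eq by (intro openin_half_plane_with_boundary) simp
qed

lemma in_topspace_pruefer [simp]:
  "Inr q \<in> topspace pruefer" "Inl (x, y) \<in> topspace pruefer \<longleftrightarrow> 0 < x"
  by (auto simp: topspace_pruefer Inl_in_pruefer_set)

lemma in_pruefer_zeros [simp]: "Inr (c, u) \<in> pruefer_zeros \<longleftrightarrow> u = 0" "Inl q \<notin> pruefer_zeros"
  by (auto simp: pruefer_zeros_def)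

text \<open>For \<open>\<sigma> = 1\<close> and \<open>\<sigma> = -1\<close> these are the upper and the lower side of the point \<open>(0, c)\<close>: half of
the punctured line with the part of the half plane above, respectively below, the height \<open>c\<close>.\<close>

definition wedge :: "real \<Rightarrow> real \<Rightarrow> pruefer_point set" where
  "wedge \<sigma> c = chart c ` ({u. 0 < \<sigma> * u} \<times> {0..})"

lemma in_wedge:
  "Inr (d, u) \<in> wedge \<sigma> c \<longleftrightarrow> d = c \<and> 0 < \<sigma> * u"
  "Inl (x, y) \<in> wedge \<sigma> c \<longleftrightarrow> 0 < x \<and> 0 < \<sigma> * (y - c)"
  unfolding wedge_def in_chart_image by (auto simp: zero_less_divide_iff)

lemma openin_wedge: "openin pruefer (wedge \<sigma> c)"
  unfolding wedge_def by (intro openin_chart_Times open_Collect_less continuous_intros)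

lemma wedge_subset_punctured_set: "wedge \<sigma> c \<subseteq> punctured_set"
proof
  fix p assume p: "p \<in> wedge \<sigma> c"
  then show "p \<in> punctured_set"
    by (cases p) (auto simp: in_wedge)
qed

lemma punctured_set_wedges:
  assumes "p \<in> punctured_set"
  obtains \<sigma> c where "\<bar>\<sigma>\<bar> = 1" "p \<in> wedge \<sigma> c"
proof (cases p)
  case (Inl q)
  then show thesis
    using assms that[of 1 "snd q - 1"] by (cases q) (auto simp: in_wedge)
next
  case (Inr q)
  then show thesis
    using assms that[of "sgn (snd q)" "fst q"]
    by (cases q) (auto simp: in_wedge abs_sgn_eq sgn_if)
qed

section \<open>Separability and non-metrizability\<close>

text \<open>The interior is dense, because each neighbourhood of a boundary point contains points of the half
plane.\<close>

lemma openin_pruefer_meets_half_plane: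
  assumes "openin pruefer S" "p \<in> S"
  obtains V where "open V" "V \<noteq> {}" "V \<subseteq> half_plane" "Inl ` V \<subseteq> S"
proof -
  have "\<exists>q. Inl q \<in> S"
  proof (cases p)
    case (Inr q)
    obtain c u where "p = Inr (c, u)"
      using Inr by (cases q) auto
    then obtain e where e: "0 < e" "pruefer_nbhd c (u - e) (u + e) e \<subseteq> S"
      using assms openin_pruefer_boundary_point by metis
    moreover have "Inl (e / 2, c + u * (e / 2)) \<in> pruefer_nbhd c (u - e) (u + e) e"
      using e(1) by (auto simp: in_pruefer_nbhd algebra_simps)
    ultimately show ?thesis
      by blast
  qed (use assms in auto)
  then obtain q V where "open V" "q \<in> V" "V \<subseteq> half_plane" "Inl ` V \<subseteq> S"
    using assms unfolding openin_pruefer pruefer_open_def by meson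
  then show thesis
    using that by blast
qed

lemma countable_dense_subset_of_half_plane:
  obtains D where "countable D" "D \<subseteq> half_plane"
    "\<And>S p. \<lbrakk>openin pruefer S; p \<in> S\<rbrakk> \<Longrightarrow> \<exists>q\<in>D. Inl q \<in> S"
proof -
  obtain D :: "(real \<times> real) set" where D: "countable D" "\<And>V. \<lbrakk>open V; V \<noteq> {}\<rbrakk> \<Longrightarrow> \<exists>q\<in>D. q \<in> V"
    using countable_dense_setE by blast
  show thesis
  proof
    show "countable (D \<inter> half_plane)"
      using D(1) by auto
    show "\<exists>q\<in>D \<inter> half_plane. Inl q \<in> S" if S: "openin pruefer S" "p \<in> S" for S p
    proof -
      obtain V where V: "open V" "V \<noteq> {}" "V \<subseteq> half_plane" "Inl ` V \<subseteq> S"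
        using openin_pruefer_meets_half_plane[OF S] by blast
      then obtain q where "q \<in> D" "q \<in> V"
        using D(2) by blast
      with V show ?thesis
        by blast
    qed
  qed auto
qed

lemma separable_pruefer: "separable_space pruefer"
proof -
  obtain D where D: "countable D" "D \<subseteq> half_plane" "\<And>S p. \<lbrakk>openin pruefer S; p \<in> S\<rbrakk> \<Longrightarrow> \<exists>q\<in>D. Inl q \<in> S"
    using countable_dense_subset_of_half_plane by blast
  have "Inl ` D \<subseteq> topspace pruefer"
    using D(2) by (auto simp: topspace_pruefer pruefer_set_def)
  moreover have "pruefer closure_of (Inl ` D) = topspace pruefer"
    unfolding dense_intersects_open using D(3) by blast
  ultimately show ?thesis
    using D(1) unfolding separable_space_def by (intro exI[of _ "Inl ` D"]) auto
qed

text \<open>In a metric each point \<open>1\<close> of a line has a ball that avoids all other lines. After replacing its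
radius by some \<open>2 / Suc n\<close> and choosing a member of a countable dense set in the ball of half that
radius, uncountably many lines would be distinguished by countably many pairs.\<close>

lemma not_metrizable_punctured: "\<not> metrizable_space punctured"
proof
  assume "metrizable_space punctured"
  then obtain M d where "Metric_space M d" and top: "punctured = Metric_space.mtopology M d"
    by (auto simp: metrizable_space_def)
  then interpret Metric_space M d
    by simp
  have M: "M = punctured_set"
    using arg_cong[OF top, of topspace] by auto
  have openin_M: "openin mtopology S" if "openin pruefer S" "S \<subseteq> punctured_set" for S
    using that openin_punctured_set by (simp flip: top add: openin_open_subtopology)
  have pruefer_openin: "openin pruefer S" if "openin mtopology S" for S
    using that openin_punctured_set by (simp flip: top add: openin_open_subtopology)
  obtain D where D: "countable D" "D \<subseteq> half_plane" "\<And>S p. \<lbrakk>openin pruefer S; p \<in> S\<rbrakk> \<Longrightarrow> \<exists>q\<in>D. Inl q \<in> S"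
    using countable_dense_subset_of_half_plane by blast
  have one_in: "Inr (c, 1) \<in> M" for c
    by (simp add: M)
  have "\<exists>n q. q \<in> D \<and> mball (Inr (c, 1)) (2 / Suc n) \<subseteq> wedge 1 c \<and> d (Inr (c, 1)) (Inl q) < 1 / Suc n" for c
  proof -
    have "openin mtopology (wedge 1 c)" "Inr (c, 1) \<in> wedge 1 c"
      by (simp_all add: in_wedge openin_M[OF openin_wedge wedge_subset_punctured_set])
    then obtain r where r: "0 < r" "mball (Inr (c, 1)) r \<subseteq> wedge 1 c"
      by (auto simp: openin_mtopology)
    then obtain n where "1 / Suc n < r / 2"
      using reals_Archimedean[of "r / 2"] by (auto simp: inverse_eq_divide)
    then have "mball (Inr (c, 1)) (2 / Suc n) \<subseteq> wedge 1 c"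
      using r(2) mball_subset_concentric[of "2 / Suc n" r "Inr (c, 1)"] by auto
    moreover have "\<exists>q\<in>D. Inl q \<in> mball (Inr (c, 1)) (1 / Suc n)"
      using one_in by (intro D(3)[of _ "Inr (c, 1)"] pruefer_openin) auto
    ultimately show ?thesis
      by (auto simp: in_mball)
  qed
  then obtain n q where q: "\<And>c. q c \<in> D" and ball: "\<And>c. mball (Inr (c, 1)) (2 / Suc (n c)) \<subseteq> wedge 1 c"
    and near: "\<And>c. d (Inr (c, 1)) (Inl (q c)) < 1 / Suc (n c)"
    by metis
  have "inj (\<lambda>c. (n c, q c))"
  proof (rule injI)
    fix c c'
    assume eq: "(n c, q c) = (n c', q c')"
    have "Inl (q c) \<in> M"
      using q[of c] D(2) by (cases "q c") (auto simp: M half_plane_def)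
    then have "d (Inr (c, 1)) (Inr (c', 1)) \<le> d (Inr (c, 1)) (Inl (q c)) + d (Inr (c', 1)) (Inl (q c))"
      using triangle[of "Inr (c, 1)" "Inl (q c)" "Inr (c', 1)"] one_in by (simp add: commute)
    also have "\<dots> < 1 / Suc (n c) + 1 / Suc (n c)"
      using near[of c] near[of c'] eq by (intro add_strict_mono) auto
    finally have "Inr (c', 1) \<in> mball (Inr (c, 1)) (2 / Suc (n c))"
      using one_in by (simp add: in_mball)
    then show "c = c'"
      using ball[of c] by (auto simp: in_wedge)
  qed
  moreover have "countable (range (\<lambda>c. (n c, q c)))"
    using q by (intro countable_subset[OF _ countable_SIGMA[of UNIV "\<lambda>_. D"]] D(1)) auto
  ultimately have "countable (UNIV :: real set)"
    using countable_image_inj_on by blast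
  then show False
    using uncountable_UNIV_real by blast
qed

section \<open>Contractibility of the Pruefer surface\<close>

text \<open>In both homotopies below, the coordinates are quotients whose denominator vanishes at the very points
where a boundary line has just been collapsed. There the bound \<open>B\<close> squeezes the quotient to \<open>0\<close>,
which is also its value, as division by \<open>0\<close> gives \<open>0\<close>.\<close>

lemma continuous_on_divide_bounded:
  fixes N D B :: "'a::topological_space \<Rightarrow> real"
  assumes cont: "continuous_on S N" "continuous_on S D" "continuous_on S B"
    and le: "\<And>p. p \<in> S \<Longrightarrow> \<bar>N p / D p\<bar> \<le> B p"
    and zero: "\<And>p. \<lbrakk>p \<in> S; D p = 0\<rbrakk> \<Longrightarrow> B p = 0"
  shows "continuous_on S (\<lambda>p. N p / D p)"
  unfolding continuous_on_def
proof
  fix p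
  assume p: "p \<in> S"
  show "((\<lambda>p. N p / D p) \<longlongrightarrow> N p / D p) (at p within S)"
  proof (cases "D p = 0")
    case False
    then show ?thesis
      using cont p by (intro tendsto_divide) (auto simp: continuous_on_def)
  next
    case True
    have "(B \<longlongrightarrow> 0) (at p within S)"
      using cont(3) p zero[OF p True] by (metis continuous_on_def)
    moreover have "\<forall>\<^sub>F q in at p within S. norm (N q / D q) \<le> B q"
      using le by (auto simp: eventually_at_filter)
    ultimately have "((\<lambda>p. N p / D p) \<longlongrightarrow> 0) (at p within S)"
      by (rule Lim_null_comparison[rotated])
    then show ?thesis
      using True by simp
  qed
qed

text \<open>Both homotopies preserve the image of every chart, so they are given there by explicit formulas
\<open>G c\<close>; the condition \<open>eq\<close> says that these formulas fit together to a map of the whole surface.\<close>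

lemma homotopic_pruefer_via_charts:
  assumes cont: "\<And>c. continuous_on ({0..1} \<times> (UNIV \<times> {0..})) (\<lambda>(t::real, q). G c t q)"
    and nonneg: "\<And>c t q. \<lbrakk>t \<in> {0..1}; q \<in> UNIV \<times> {0..}\<rbrakk> \<Longrightarrow> 0 \<le> snd (G c t q)"
    and eq: "\<And>c t q. \<lbrakk>t \<in> {0..1}; q \<in> UNIV \<times> {0..}\<rbrakk> \<Longrightarrow> H (t, chart c q) = chart c (G c t q)"
    and ends: "\<And>p. p \<in> pruefer_set \<Longrightarrow> H (0, p) = f p" "\<And>p. p \<in> pruefer_set \<Longrightarrow> H (1, p) = g p"
  shows "homotopic_with (\<lambda>h. True) pruefer pruefer f g"
proof -
  have "continuous_map (prod_topology (top_of_set {0..1}) pruefer) pruefer H"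
  proof (rule continuous_map_from_prod_pruefer)
    fix c
    have "continuous_map (top_of_set ({0..1} \<times> (UNIV \<times> {0..}))) (top_of_set (UNIV \<times> {0..})) (\<lambda>(t, q). G c t q)"
      using cont[of c] nonneg[of _ _ c] by (auto simp: continuous_map_in_subtopology mem_Times_iff)
    then have "continuous_map (top_of_set ({0..1} \<times> (UNIV \<times> {0..}))) pruefer (chart c \<circ> (\<lambda>(t, q). G c t q))"
      using continuous_map_chart by (rule continuous_map_compose)
    then have "continuous_map (top_of_set ({0..1} \<times> (UNIV \<times> {0..}))) pruefer (\<lambda>(t, q). H (t, chart c q))"
      by (rule continuous_map_eq) (auto simp: eq)
    then show "continuous_map (prod_topology (top_of_set {0..1}) (top_of_set (UNIV \<times> {0..}))) pruefer
        (\<lambda>(t, q). H (t, chart c q))"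
      by simp
  qed
  then show ?thesis
    using ends by (subst homotopic_with) (auto simp: topspace_pruefer)
qed

text \<open>The result of the first stage: every boundary line is collapsed to its zero point. Any function of
\<open>x\<close> that tends to \<open>0\<close> more slowly than \<open>x\<close> could take the place of the square root.\<close>

definition flatten :: "pruefer_point \<Rightarrow> pruefer_point" where
  "flatten p = (case p of Inl (x, y) \<Rightarrow> Inl (sqrt x, y) | Inr (c, u) \<Rightarrow> Inr (c, 0))"

text \<open>With \<open>r t x = 1 - t + t * sqrt x\<close> the motion \<open>(x, y) \<mapsto> (x / r t x, y)\<close> multiplies all slopes
by \<open>r t x\<close>, which is \<open>1 - t\<close> on the boundary. The abscissa \<open>x / r t x\<close> is critical only at
\<open>t = 1\<close>, \<open>x = 0\<close>, and since \<open>r t x\<close> lies between \<open>1\<close> and \<open>sqrt x\<close>, it is at most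
\<open>x + sqrt x\<close>.\<close>

lemma id_homotopic_flatten: "homotopic_with (\<lambda>h. True) pruefer pruefer id flatten"
proof -
  define r :: "real \<Rightarrow> real \<Rightarrow> real" where "r t x = 1 - t + t * sqrt x" for t x
  have r_ge: "min 1 (sqrt x) \<le> r t x" if "t \<in> {0..1}" "0 \<le> x" for t x
  proof -
    have "min 1 (sqrt x) * (1 - t) + min 1 (sqrt x) * t \<le> 1 * (1 - t) + sqrt x * t"
      using that by (intro add_mono mult_right_mono) auto
    then show ?thesis
      by (simp add: r_def algebra_simps)
  qed
  have r_pos: "0 < r t x" if "t \<in> {0..1}" "0 < x" for t x
    using r_ge[of t x] that by (smt (verit) real_sqrt_gt_zero)
  have r_nonneg: "0 \<le> r t x" if "t \<in> {0..1}" "0 \<le> x" for t x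
    using r_ge[of t x] that by (smt (verit) real_sqrt_ge_zero)
  have bound: "\<bar>x / r t x\<bar> \<le> x + sqrt x" if "t \<in> {0..1}" "0 \<le> x" for t x
  proof (cases "x = 0")
    case False
    then have pos: "0 < min 1 (sqrt x)" "0 < x"
      using that by auto
    have "\<bar>x / r t x\<bar> = x / r t x"
      using that r_nonneg by simp
    also have "\<dots> \<le> x / min 1 (sqrt x)"
      using r_ge[OF that] pos by (intro divide_left_mono mult_pos_pos r_pos) (use that in auto)
    also have "\<dots> \<le> x + sqrt x"
      using pos by (auto simp: min_def real_div_sqrt)
    finally show ?thesis .
  qed auto
  define H :: "real \<times> pruefer_point \<Rightarrow> pruefer_point" where
    "H = (\<lambda>(t, p). case p of Inl (x, y) \<Rightarrow> Inl (x / r t x, y) | Inr (c, u) \<Rightarrow> Inr (c, (1 - t) * u))"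
  show ?thesis
  proof (rule homotopic_pruefer_via_charts[where H = H and G = "\<lambda>c t q. (fst q * r t (snd q), snd q / r t (snd q))"])
    fix c :: real
    have "continuous_on ({0..1} \<times> (UNIV \<times> {0..})) (\<lambda>z::real \<times> real \<times> real. snd (snd z) / r (fst z) (snd (snd z)))"
      using bound
      by (intro continuous_on_divide_bounded[where B = "\<lambda>z. snd (snd z) + sqrt (snd (snd z))"])
         (auto simp: r_def add_nonneg_eq_0_iff intro!: continuous_intros)
    moreover have "continuous_on ({0..1} \<times> (UNIV \<times> {0..})) (\<lambda>z::real \<times> real \<times> real. fst (snd z) * r (fst z) (snd (snd z)))"
      unfolding r_def by (intro continuous_intros)
    ultimately show "continuous_on ({0..1} \<times> (UNIV \<times> {0..}))
        (\<lambda>(t, q::real \<times> real). (fst q * r t (snd q), snd q / r t (snd q)))"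
      by (simp add: case_prod_unfold continuous_on_Pair)
  next
    fix c t :: real and q :: "real \<times> real"
    assume tq: "t \<in> {0..1}" "q \<in> UNIV \<times> {0..}"
    then show "0 \<le> snd (fst q * r t (snd q), snd q / r t (snd q))"
      using r_nonneg by (auto simp: mem_Times_iff)
    obtain u x where [simp]: "q = (u, x)"
      by (cases q)
    have "0 \<le> x"
      using tq by simp
    then show "H (t, chart c q) = chart c (fst q * r t (snd q), snd q / r t (snd q))"
      using r_pos[OF tq(1), of x] by (cases "x = 0") (auto simp: H_def chart_def r_def)
  next
    fix p :: pruefer_point
    assume "p \<in> pruefer_set"
    then show "H (0, p) = id p" "H (1, p) = flatten p"
      by (auto simp: H_def r_def flatten_def Inl_in_pruefer_set real_div_sqrt split: sum.split)
  qed
qed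

definition push_inside :: "pruefer_point \<Rightarrow> real \<times> real" where
  "push_inside p = (case p of Inl (x, y) \<Rightarrow> (1 + sqrt x, y) | Inr (c, u) \<Rightarrow> (1, c))"

text \<open>All lines start at their zero points, so the motion in the horizontal direction is continuous: at time
\<open>s\<close> the slope \<open>u\<close> at abscissa \<open>x\<close> has become \<open>u * x / (s + sqrt x)\<close>, which tends to \<open>0\<close> as
\<open>x\<close> and \<open>s\<close> do. Without the first stage the factor would be \<open>x / (s + x)\<close>, with no limit.\<close>

lemma flatten_homotopic_push_inside:
  "homotopic_with (\<lambda>h. True) pruefer pruefer flatten (Inl \<circ> push_inside)"
proof -
  define H :: "real \<times> pruefer_point \<Rightarrow> pruefer_point" where
    "H = (\<lambda>(s, p). case p of Inl (x, y) \<Rightarrow> Inl (s + sqrt x, y) | Inr (c, u) \<Rightarrow> chart c (0, s))"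
  let ?G = "\<lambda>s q. (fst q * snd q / (s + sqrt (snd q)), s + sqrt (snd q))"
  show ?thesis
  proof (rule homotopic_pruefer_via_charts[where H = H and G = "\<lambda>c. ?G"])
    fix c :: real
    have bound: "\<bar>u * x / (s + sqrt x)\<bar> \<le> \<bar>u\<bar> * sqrt x" if "s \<in> {0..1}" "0 \<le> x" for s u x :: real
    proof (cases "x = 0")
      case False
      have "\<bar>u * x / (s + sqrt x)\<bar> = \<bar>u\<bar> * (x / (s + sqrt x))"
        using that by (simp add: abs_mult)
      also have "\<dots> \<le> \<bar>u\<bar> * (x / sqrt x)"
        using that False by (intro mult_left_mono divide_left_mono) (auto intro!: mult_pos_pos add_nonneg_pos)
      finally show ?thesis
        using that by (simp add: real_div_sqrt)
    qed auto
    have "continuous_on ({0..1} \<times> (UNIV \<times> {0..}))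
        (\<lambda>z::real \<times> real \<times> real. fst (snd z) * snd (snd z) / (fst z + sqrt (snd (snd z))))"
      using bound
      by (intro continuous_on_divide_bounded[where B = "\<lambda>z. \<bar>fst (snd z)\<bar> * sqrt (snd (snd z))"])
         (auto simp: add_nonneg_eq_0_iff intro!: continuous_intros)
    moreover have "continuous_on ({0..1} \<times> (UNIV \<times> {0..})) (\<lambda>z::real \<times> real \<times> real. fst z + sqrt (snd (snd z)))"
      by (intro continuous_intros)
    ultimately show "continuous_on ({0..1} \<times> (UNIV \<times> {0..})) (\<lambda>(s::real, q::real \<times> real). ?G s q)"
      by (simp add: case_prod_unfold continuous_on_Pair)
  next
    fix c s :: real and q :: "real \<times> real"
    assume sq: "s \<in> {0..1}" "q \<in> UNIV \<times> {0..}"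
    then show "0 \<le> snd (?G s q)"
      by (auto simp: mem_Times_iff)
    obtain u x where [simp]: "q = (u, x)"
      by (cases q)
    have "0 < s + sqrt x" if "0 < x"
      using sq that by (auto intro: add_nonneg_pos)
    then show "H (s, chart c q) = chart c (?G s q)"
      using sq by (cases "x = 0") (auto simp: H_def chart_def)
  next
    fix p :: pruefer_point
    assume "p \<in> pruefer_set"
    then show "H (0, p) = flatten p" "H (1, p) = (Inl \<circ> push_inside) p"
      by (auto simp: H_def flatten_def push_inside_def chart_def split: sum.split)
  qed
qed

lemma continuous_map_push_inside: "continuous_map pruefer (top_of_set half_plane) push_inside"
proof -
  have push: "continuous_map (prod_topology (top_of_set {0::real}) pruefer) (top_of_set half_plane) (\<lambda>(t, p). push_inside p)"
  proof (rule continuous_map_from_prod_pruefer)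
    fix c :: real
    have "continuous_on ({0::real} \<times> UNIV \<times> {0..}) (\<lambda>z. (1 + sqrt (snd (snd z)), c + fst (snd z) * snd (snd z)))"
      by (intro continuous_intros)
    then have "continuous_map (top_of_set ({0::real} \<times> UNIV \<times> {0..})) (top_of_set half_plane)
        (\<lambda>z. (1 + sqrt (snd (snd z)), c + fst (snd z) * snd (snd z)))"
      by (auto simp: continuous_map_in_subtopology half_plane_def intro: add_pos_nonneg)
    then have "continuous_map (top_of_set ({0::real} \<times> UNIV \<times> {0..})) (top_of_set half_plane)
        (\<lambda>(t, q). (\<lambda>(t, p). push_inside p) (t, chart c q))"
      by (rule continuous_map_eq) (auto simp: push_inside_def chart_def)
    then show "continuous_map (prod_topology (top_of_set {0::real}) (top_of_set (UNIV \<times> {0..}))) (top_of_set half_plane)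
        (\<lambda>(t, q). (\<lambda>(t, p). push_inside p) (t, chart c q))"
      by simp
  qed
  have "continuous_map pruefer (prod_topology (top_of_set {0::real}) pruefer) (\<lambda>p. (0, p))"
    by (simp add: continuous_map_pairwise o_def)
  from continuous_map_compose[OF this push] show ?thesis
    by (simp add: o_def)
qed

lemma continuous_map_Inl_pruefer: "continuous_map (top_of_set half_plane) pruefer Inl"
  unfolding continuous_map_def
proof (intro conjI allI impI)
  show "Inl \<in> topspace (top_of_set half_plane) \<rightarrow> topspace pruefer"
    by (auto simp: topspace_pruefer pruefer_set_def)
  fix S
  assume "openin pruefer S"
  then have nbhd: "\<exists>V. open V \<and> q \<in> V \<and> V \<subseteq> half_plane \<and> Inl ` V \<subseteq> S" if "Inl q \<in> S" for q
    using that unfolding openin_pruefer pruefer_open_def by meson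
  have "open {q \<in> half_plane. Inl q \<in> S}"
  proof (subst open_subopen, intro ballI)
    fix q
    assume "q \<in> {q \<in> half_plane. Inl q \<in> S}"
    then obtain V where "open V" "q \<in> V" "V \<subseteq> half_plane" "Inl ` V \<subseteq> S"
      using nbhd[of q] by auto
    then show "\<exists>T. open T \<and> q \<in> T \<and> T \<subseteq> {q \<in> half_plane. Inl q \<in> S}"
      by (intro exI[of _ V]) auto
  qed
  then show "openin (top_of_set half_plane) {q \<in> topspace (top_of_set half_plane). Inl q \<in> S}"
    by (simp add: open_openin_trans[OF open_half_plane])
qed

lemma convex_half_plane: "convex half_plane"
proof -
  have "half_plane = {0<..} \<times> UNIV"
    by (auto simp: half_plane_def)
  then show ?thesis
    by (metis convex_Times convex_UNIV convex_real_interval(3))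
qed

lemma contractible_pruefer: "contractible_space pruefer"
proof -
  have "contractible_space (top_of_set half_plane)"
    using convex_half_plane by (simp add: convex_imp_contractible)
  then obtain p where "homotopic_with (\<lambda>h. True) pruefer pruefer (Inl \<circ> push_inside) (\<lambda>_. p)"
    using nullhomotopic_through_contractible_space[OF continuous_map_push_inside continuous_map_Inl_pruefer] by blast
  then show ?thesis
    unfolding contractible_space_def
    using id_homotopic_flatten flatten_homotopic_push_inside homotopic_with_trans by blast
qed

section \<open>Manifold structure\<close>

lemma Hausdorff_pruefer: "Hausdorff_space pruefer"
  unfolding Hausdorff_space_def topspace_pruefer
proof (intro allI impI)
  fix p q
  assume pq: "p \<in> pruefer_set \<and> q \<in> pruefer_set \<and> p \<noteq> q"
  show "\<exists>U V. openin pruefer U \<and> openin pruefer V \<and> p \<in> U \<and> q \<in> V \<and> disjnt U V"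
  proof (cases "\<exists>c. p \<in> chart c ` (UNIV \<times> {0..}) \<and> q \<in> chart c ` (UNIV \<times> {0..})")
    case True
    then obtain c where c: "p \<in> chart c ` (UNIV \<times> {0..})" "q \<in> chart c ` (UNIV \<times> {0..})"
      by auto
    let ?U = "chart c ` (UNIV \<times> {0..})"
    have "Hausdorff_space (top_of_set (UNIV \<times> {0::real..}) :: (real \<times> real) topology)"
      by (intro Hausdorff_space_subtopology Hausdorff_space_euclidean)
    then have "Hausdorff_space (subtopology pruefer ?U)"
      using homeomorphic_Hausdorff_space homeomorphic_maps_imp_homeomorphic_space homeomorphic_maps_chart
      by blast
    moreover have "p \<in> topspace (subtopology pruefer ?U)" "q \<in> topspace (subtopology pruefer ?U)"
      using c by (auto simp: topspace_pruefer)
    ultimately obtain A B where "openin (subtopology pruefer ?U) A" "openin (subtopology pruefer ?U) B"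
        "p \<in> A" "q \<in> B" "disjnt A B"
      using pq unfolding Hausdorff_space_def by metis
    then show ?thesis
      using openin_open_subtopology[OF openin_chart_Times[of UNIV c]] by auto
  next
    case False
    then obtain c u d v where [simp]: "p = Inr (c, u)" "q = Inr (d, v)"
      using pq by (cases p; cases q) (auto simp: in_chart_image Inl_in_pruefer_set)
    have "c \<noteq> d"
      using False by (auto simp: in_chart_image)
    \<comment> \<open>Points of different lines lie in no common chart. In their sectors \<open>y\<close> differs from \<open>c\<close> and
      \<open>d\<close> by at most \<open>(\<bar>u\<bar> + 1) * x\<close> and \<open>(\<bar>v\<bar> + 1) * x\<close>, too little for both if \<open>x < e\<close>.\<close>
    define e where "e = \<bar>c - d\<bar> / (\<bar>u\<bar> + \<bar>v\<bar> + 2)"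
    have e: "0 < e" "e * (\<bar>u\<bar> + \<bar>v\<bar> + 2) = \<bar>c - d\<bar>"
      using \<open>c \<noteq> d\<close> by (auto simp: e_def intro!: divide_pos_pos)
    have "disjnt (pruefer_nbhd c (u - 1) (u + 1) e) (pruefer_nbhd d (v - 1) (v + 1) e)"
      unfolding disjnt_iff
    proof (intro allI notI)
      fix z
      assume z: "z \<in> pruefer_nbhd c (u - 1) (u + 1) e \<and> z \<in> pruefer_nbhd d (v - 1) (v + 1) e"
      show False
      proof (cases z)
        case (Inl w)
        obtain x y where [simp]: "w = (x, y)"
          by (cases w)
        have *: "0 < x" "x < e" "\<bar>y - c\<bar> \<le> (\<bar>u\<bar> + 1) * x" "\<bar>y - d\<bar> \<le> (\<bar>v\<bar> + 1) * x"
        proof -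
          show "0 < x" "x < e"
            using z Inl by (auto simp: in_pruefer_nbhd)
          have "u * x \<le> \<bar>u\<bar> * x" "v * x \<le> \<bar>v\<bar> * x" "- u * x \<le> \<bar>u\<bar> * x" "- v * x \<le> \<bar>v\<bar> * x"
            using \<open>0 < x\<close> by (intro mult_right_mono; simp)+
          moreover have "u * x - x < y - c" "y - c < u * x + x" "v * x - x < y - d" "y - d < v * x + x"
            using z Inl by (auto simp: in_pruefer_nbhd algebra_simps)
          ultimately show "\<bar>y - c\<bar> \<le> (\<bar>u\<bar> + 1) * x" "\<bar>y - d\<bar> \<le> (\<bar>v\<bar> + 1) * x"
            unfolding distrib_right abs_le_iff by linarith+
        qed
        have "\<bar>c - d\<bar> \<le> (\<bar>u\<bar> + \<bar>v\<bar> + 2) * x"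
          using *(3,4) by (auto simp: algebra_simps)
        also have "\<dots> < (\<bar>u\<bar> + \<bar>v\<bar> + 2) * e"
          using * by (intro mult_strict_left_mono) auto
        finally show False
          using e(2) by (simp add: mult.commute)
      next
        case (Inr w)
        then show False
          using z \<open>c \<noteq> d\<close> by (cases w) (auto simp: in_pruefer_nbhd)
      qed
    qed
    then show ?thesis
      using openin_pruefer_nbhd[OF e(1)]
      by (intro exI[of _ "pruefer_nbhd c (u - 1) (u + 1) e"] exI[of _ "pruefer_nbhd d (v - 1) (v + 1) e"])
         (simp add: in_pruefer_nbhd)
  qed
qed

lemma euclideanreal_homeomorphic_Euclidean_space_1: "euclideanreal homeomorphic_space Euclidean_space 1"
proof -
  have "Euclidean_space 1 homeomorphic_space product_topology (\<lambda>i. euclideanreal) {0::nat}"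
    using homeomorphic_Euclidean_space_product_topology[of 1] by (simp add: lessThan_Suc)
  also have "\<dots> homeomorphic_space euclideanreal"
    by (rule homeomorphic_space_singleton_product)
  finally show ?thesis
    by (rule homeomorphic_space_sym[THEN iffD1])
qed

lemma chart_image_homeomorphic_half_space:
  assumes "top_of_set J homeomorphic_space euclideanreal"
  shows "subtopology pruefer (chart c ` (J \<times> {0..})) homeomorphic_space
         prod_topology (Euclidean_space (2 - 1)) (top_of_set {0::real..})"
proof -
  have "subtopology pruefer (chart c ` (J \<times> {0..})) homeomorphic_space top_of_set (J \<times> {0::real..})"
    by (subst homeomorphic_space_sym) (rule homeomorphic_maps_imp_homeomorphic_space[OF homeomorphic_maps_chart])
  also have "top_of_set (J \<times> {0::real..}) = prod_topology (top_of_set J) (top_of_set {0::real..})"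
    by simp
  also have "\<dots> homeomorphic_space prod_topology (Euclidean_space (2 - 1)) (top_of_set {0::real..})"
    using assms euclideanreal_homeomorphic_Euclidean_space_1
    by (intro homeomorphic_space_prod_topology) (auto intro: homeomorphic_space_trans homeomorphic_space_refl)
  finally show ?thesis .
qed

text \<open>A half line is homeomorphic to the line by the logarithm. Since the wedges also cover the half plane,
they are all that is needed to chart the punctured surface.\<close>

lemma wedge_homeomorphic_half_space:
  assumes "\<bar>\<sigma>\<bar> = 1"
  shows "subtopology pruefer (wedge \<sigma> c) homeomorphic_space
         prod_topology (Euclidean_space (2 - 1)) (top_of_set {0::real..})"
proof -
  have [simp]: "\<sigma> * (\<sigma> * u) = u" for u
    using assms by (cases "\<sigma> < 0") auto
  have "homeomorphic_maps (top_of_set {u. 0 < \<sigma> * u}) euclideanreal (\<lambda>u. ln (\<sigma> * u)) (\<lambda>v. \<sigma> * exp v)"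
    unfolding homeomorphic_maps_def
    by (auto simp: continuous_map_in_subtopology intro!: continuous_intros)
  then show ?thesis
    unfolding wedge_def
    by (intro chart_image_homeomorphic_half_space homeomorphic_maps_imp_homeomorphic_space)
qed

lemma manifold_pruefer: "manifold_with_boundary 2 pruefer"
  unfolding manifold_with_boundary_def
proof (intro conjI ballI)
  show "connected_space pruefer"
    by (simp add: contractible_imp_connected_space contractible_pruefer)
  fix p assume "p \<in> topspace pruefer"
  then obtain c where "p \<in> chart c ` (UNIV \<times> {0..})"
    unfolding topspace_pruefer by (metis pruefer_set_charts)
  moreover have "subtopology pruefer (chart c ` (UNIV \<times> {0..})) homeomorphic_space
      prod_topology (Euclidean_space (2 - 1)) (top_of_set {0::real..})"
    by (rule chart_image_homeomorphic_half_space) (simp add: homeomorphic_space_refl)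
  ultimately show "\<exists>U. openin pruefer U \<and> p \<in> U \<and>
      (subtopology pruefer U homeomorphic_space Euclidean_space 2 \<or>
       subtopology pruefer U homeomorphic_space prod_topology (Euclidean_space (2 - 1)) (top_of_set {0::real..}))"
    using openin_chart_Times[of UNIV c] by auto
qed (auto simp: Hausdorff_pruefer)

lemma connected_space_punctured: "connected_space punctured"
proof -
  have "connectedin pruefer (Inl ` half_plane)"
    using connectedin_continuous_map_image[OF continuous_map_Inl_pruefer, of half_plane] convex_half_plane
    by (simp add: connectedin_subtopology convex_connected)
  moreover have "Inl ` half_plane \<subseteq> punctured_set"
    by (auto simp: punctured_set_eq half_plane_with_boundary_def)
  moreover have "punctured_set \<subseteq> pruefer closure_of (Inl ` half_plane)"
  proof -
    have "pruefer closure_of (Inl ` half_plane) = topspace pruefer"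
      unfolding dense_intersects_open by (blast elim: openin_pruefer_meets_half_plane)
    then show ?thesis
      by blast
  qed
  ultimately have "connectedin pruefer punctured_set"
    using connectedin_intermediate_closure_of by blast
  then show ?thesis
    by (simp add: connectedin_def)
qed

lemma manifold_punctured: "manifold_with_boundary 2 punctured"
  unfolding manifold_with_boundary_def
proof (intro conjI ballI)
  show "connected_space punctured"
    by (rule connected_space_punctured)
  show "Hausdorff_space punctured"
    by (simp add: Hausdorff_pruefer Hausdorff_space_subtopology)
  fix p assume "p \<in> topspace punctured"
  then obtain \<sigma> c where \<sigma>: "\<bar>\<sigma>\<bar> = 1" "p \<in> wedge \<sigma> c"
    using punctured_set_wedges by auto
  have "subtopology punctured (wedge \<sigma> c) = subtopology pruefer (wedge \<sigma> c)"
    using wedge_subset_punctured_set[of \<sigma> c] by (simp add: subtopology_subtopology Int_absorb1)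
  moreover have "openin punctured (wedge \<sigma> c)"
    using wedge_subset_punctured_set openin_wedge openin_punctured_set by (simp add: openin_open_subtopology)
  ultimately show "\<exists>U. openin punctured U \<and> p \<in> U \<and>
      (subtopology punctured U homeomorphic_space Euclidean_space 2 \<or>
       subtopology punctured U homeomorphic_space prod_topology (Euclidean_space (2 - 1)) (top_of_set {0::real..}))"
    using \<sigma> wedge_homeomorphic_half_space by metis
qed auto

section \<open>Homotopies of the punctured surface\<close>

text \<open>The sign \<open>\<sigma>\<close> is the side from which \<open>c\<close> is approximated. If every point of \<open>S\<close> had a gap on this
side, then choosing a rational number in each gap would be injective.\<close>

lemma uncountable_one_sided_limit_point:
  fixes S :: "real set"
  assumes "uncountable S" "\<bar>\<sigma>\<bar> = 1"
  obtains c where "c \<in> S" "\<forall>\<delta>>0. \<exists>c'\<in>S. 0 < \<sigma> * (c' - c) \<and> \<sigma> * (c' - c) < \<delta>"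
proof (rule ccontr)
  assume "\<not> thesis"
  then have "\<forall>c\<in>S. \<exists>\<delta>>0. \<forall>c'\<in>S. \<not> (0 < \<sigma> * (c' - c) \<and> \<sigma> * (c' - c) < \<delta>)"
    using that by blast
  then obtain \<delta> where \<delta>: "\<And>c. c \<in> S \<Longrightarrow> 0 < \<delta> c"
      "\<And>c c'. \<lbrakk>c \<in> S; c' \<in> S; 0 < \<sigma> * (c' - c)\<rbrakk> \<Longrightarrow> \<delta> c \<le> \<sigma> * (c' - c)"
    by (metis not_le)
  have \<sigma>: "\<sigma> = 1 \<or> \<sigma> = -1"
    using assms(2) by linarith
  have "\<exists>q\<in>\<rat>. 0 < \<sigma> * (q - c) \<and> \<sigma> * (q - c) < \<delta> c" if "c \<in> S" for c
  proof -
    have "min c (c + \<sigma> * \<delta> c) < max c (c + \<sigma> * \<delta> c)"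
      using \<delta>(1)[OF that] \<sigma> by auto
    then obtain q where "q \<in> \<rat>" "min c (c + \<sigma> * \<delta> c) < q" "q < max c (c + \<sigma> * \<delta> c)"
      using Rats_dense_in_real by blast
    then show ?thesis
      using \<delta>(1)[OF that] \<sigma> by (intro bexI[of _ q]) auto
  qed
  then obtain q where q: "\<And>c. c \<in> S \<Longrightarrow> q c \<in> \<rat> \<and> 0 < \<sigma> * (q c - c) \<and> \<sigma> * (q c - c) < \<delta> c"
    by metis
  have "inj_on q S"
  proof (rule inj_onI)
    fix c c'
    assume c: "c \<in> S" "c' \<in> S" "q c = q c'"
    have "\<not> 0 < \<sigma> * (c' - c)" "\<not> 0 < \<sigma> * (c - c')"
      using \<delta>(2)[of c c'] \<delta>(2)[of c' c] q[of c] q[of c'] c by (auto simp: algebra_simps)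
    then show "c = c'"
      using \<sigma> by auto
  qed
  moreover have "countable (q ` S)"
    using q by (intro countable_subset[OF _ countable_rat]) auto
  ultimately show False
    using assms(1) countable_image_inj_on by blast
qed

lemma preimage_openin_pruefer:
  assumes "continuous_map punctured punctured k" "openin pruefer U"
  shows "openin pruefer {p \<in> punctured_set. k p \<in> U}"
proof -
  have "openin punctured {p \<in> topspace punctured. k p \<in> U \<inter> punctured_set}"
    using assms openin_punctured_set
    by (intro openin_continuous_map_preimage[OF assms(1)]) (simp add: openin_open_subtopology openin_Int)
  moreover have "{p \<in> topspace punctured. k p \<in> U \<inter> punctured_set} = {p \<in> punctured_set. k p \<in> U}"
    using continuous_map_image_subset_topspace[OF assms(1)] by auto
  ultimately show ?thesis
    using openin_punctured_set by (simp add: openin_open_subtopology)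
qed

text \<open>Here \<open>k\<close> is one stage of a homotopy. The points \<open>\<sigma>\<close> and \<open>-\<sigma>\<close> of the line \<open>c\<close> are still on their
sides of \<open>c\<close>, but the first one has reached the half plane. The half plane does not know which line a
point came from, and so this can be compared for different lines: a point \<open>(x, y)\<close> midway in height
between \<open>c\<^sub>0\<close> and \<open>c\<close>, with \<open>x\<close> half the distance of \<open>c\<^sub>0\<close> and \<open>c\<close>, has slope \<open>\<sigma>\<close>
over \<open>c\<^sub>0\<close> and slope \<open>-\<sigma>\<close> over \<open>c\<close>.\<close>

lemma countable_separated_pairs:
  assumes k: "continuous_map punctured punctured k" and \<sigma>: "\<bar>\<sigma>\<bar> = 1"
  shows "countable {c. k (Inr (c, \<sigma>)) \<in> wedge \<sigma> c \<inter> range Inl \<and> k (Inr (c, - \<sigma>)) \<in> wedge (- \<sigma>) c}"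
    (is "countable ?S")
proof -
  have \<sigma>': "\<sigma> = 1 \<or> \<sigma> = -1"
    using \<sigma> by linarith
  \<comment> \<open>Membership in \<open>T n\<close> fixes the modulus of continuity at the point \<open>-\<sigma>\<close> of the line.\<close>
  define T where "T n = {c \<in> ?S. \<forall>p \<in> pruefer_nbhd c (- \<sigma> - 1 / Suc n) (- \<sigma> + 1 / Suc n) (1 / Suc n).
    p \<in> punctured_set \<longrightarrow> k p \<in> wedge (- \<sigma>) c}" for n :: nat
  have "?S \<subseteq> (\<Union>n. T n)"
  proof
    fix c
    assume c: "c \<in> ?S"
    then have "Inr (c, - \<sigma>) \<in> {p \<in> punctured_set. k p \<in> wedge (- \<sigma>) c}"
      using \<sigma> by auto
    then obtain e where e: "0 < e" "pruefer_nbhd c (- \<sigma> - e) (- \<sigma> + e) e \<subseteq> {p \<in> punctured_set. k p \<in> wedge (- \<sigma>) c}"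
      using openin_pruefer_boundary_point[OF preimage_openin_pruefer[OF k openin_wedge]] by blast
    obtain n where n: "1 / Suc n < e"
      using reals_Archimedean[OF e(1)] by (auto simp: inverse_eq_divide)
    have "pruefer_nbhd c (- \<sigma> - 1 / Suc n) (- \<sigma> + 1 / Suc n) (1 / Suc n) \<subseteq> pruefer_nbhd c (- \<sigma> - e) (- \<sigma> + e) e"
      using n by (intro pruefer_nbhd_mono) auto
    then show "c \<in> (\<Union>n. T n)"
      using c e(2) unfolding T_def by blast
  qed
  moreover have "countable (T n)" for n
  proof (rule ccontr)
    assume "uncountable (T n)"
    then obtain c0 where c0: "c0 \<in> T n"
      and lim: "\<forall>\<delta>>0. \<exists>c\<in>T n. 0 < \<sigma> * (c - c0) \<and> \<sigma> * (c - c0) < \<delta>"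
      by (rule uncountable_one_sided_limit_point[OF _ \<sigma>]) blast
    then obtain x1 y1 where k0: "k (Inr (c0, \<sigma>)) = Inl (x1, y1)" "0 < \<sigma> * (y1 - c0)"
      by (auto simp: T_def in_wedge)
    \<comment> \<open>A height strictly between \<open>c0\<close> and the image of its point \<open>\<sigma>\<close>, in the order given by \<open>\<sigma>\<close>.\<close>
    define m where "m = (c0 + y1) / 2"
    have m: "0 < \<sigma> * (m - c0)" "0 < \<sigma> * (y1 - m)"
      using k0(2) by (auto simp: m_def field_simps)
    have "x1 > 0"
      using c0 k0 by (auto simp: T_def in_wedge)
    obtain e where e: "0 < e" "pruefer_nbhd c0 (\<sigma> - e) (\<sigma> + e) e \<subseteq> {p \<in> punctured_set. k p \<in> wedge \<sigma> m}"
    proof -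
      have "Inr (c0, \<sigma>) \<in> {p \<in> punctured_set. k p \<in> wedge \<sigma> m}"
        using \<sigma> k0 m \<open>x1 > 0\<close> by (auto simp: in_wedge)
      then show thesis
        using openin_pruefer_boundary_point[OF preimage_openin_pruefer[OF k openin_wedge]] that by blast
    qed
    define \<delta> where "\<delta> = min (\<sigma> * (m - c0)) (min e (1 / Suc n))"
    have "0 < \<delta>"
      using m e(1) by (simp add: \<delta>_def)
    then obtain c where c: "c \<in> T n" "0 < \<sigma> * (c - c0)" "\<sigma> * (c - c0) < \<delta>"
      using lim by blast
    define x y where "x = \<sigma> * (c - c0) / 2" and "y = (c + c0) / 2"
    have x: "0 < x" "x < e" "x < 1 / Suc n"
      using c by (auto simp: x_def \<delta>_def)
    have y: "y - c0 = \<sigma> * x" "y - c = - \<sigma> * x"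
      using \<sigma>' by (auto simp: x_def y_def field_simps)
    have "Inl (x, y) \<in> pruefer_nbhd c0 (\<sigma> - e) (\<sigma> + e) e"
      using x y(1) e(1) by (auto simp: in_pruefer_nbhd algebra_simps)
    then have "k (Inl (x, y)) \<in> wedge \<sigma> m"
      using e(2) by blast
    moreover have "Inl (x, y) \<in> pruefer_nbhd c (- \<sigma> - 1 / Suc n) (- \<sigma> + 1 / Suc n) (1 / Suc n)"
    proof -
      have "0 < (1 / Suc n) * x"
        using x by simp
      moreover have "y = - (\<sigma> * x) + c"
        using y(2) by simp
      ultimately show ?thesis
        using x unfolding in_pruefer_nbhd distrib_right left_diff_distrib by simp
    qed
    then have "k (Inl (x, y)) \<in> wedge (- \<sigma>) c"
      using c(1) x(1) by (auto simp: T_def)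
    ultimately obtain x' y' where "0 < \<sigma> * (y' - m)" "0 < - \<sigma> * (y' - c)"
      by (cases "k (Inl (x, y))"; cases "projl (k (Inl (x, y)))"; cases "projr (k (Inl (x, y)))") (auto simp: in_wedge)
    moreover have "\<sigma> * (c - c0) < \<sigma> * (m - c0)"
      using c by (simp add: \<delta>_def)
    ultimately show False
      by (simp add: algebra_simps)
  qed
  ultimately show ?thesis
    by (meson countable_UN countable_subset uncountable_def UNIV_I countableI_type)
qed

text \<open>Either both points \<open>1\<close> and \<open>-1\<close> of the line \<open>c\<close> stay on their half lines until the end, or
there is a time at which one of them has left its half line while both are still in their wedges. The
set of such times is open, so it contains a rational one, and \<open>countable_separated_pairs\<close> applies to
each rational time.\<close>

lemma homotopic_id_leaves_countably_many_lines:
  assumes "homotopic_with (\<lambda>h. True) punctured punctured id k"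
  shows "countable {c. k (Inr (c, 1)) \<notin> range (\<lambda>u. Inr (c, u))}"
proof -
  obtain h where h: "continuous_map (prod_topology (top_of_set {0..1::real}) punctured) punctured h"
    and h0: "\<And>p. h (0, p) = p" and h1: "\<And>p. h (1, p) = k p"
    using assms by (auto simp: homotopic_with_def)
  have cont_p: "continuous_map (top_of_set {0..1}) punctured (\<lambda>t. h (t, p))" if "p \<in> punctured_set" for p
  proof -
    have "continuous_map (top_of_set {0..1}) (prod_topology (top_of_set {0..1::real}) punctured) (\<lambda>t. (t, p))"
      using that by (simp add: continuous_map_pairwise o_def)
    from continuous_map_compose[OF this h] show ?thesis
      by (simp add: o_def)
  qed
  have cont_t: "continuous_map punctured punctured (\<lambda>p. h (t, p))" if "t \<in> {0..1}" for t
  proof -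
    have "continuous_map punctured (prod_topology (top_of_set {0..1::real}) punctured) (\<lambda>p. (t, p))"
      using that by (simp add: continuous_map_pairwise o_def)
    from continuous_map_compose[OF this h] show ?thesis
      by (simp add: o_def)
  qed
  have h_in: "h (t, p) \<in> punctured_set" if "t \<in> {0..1}" "p \<in> punctured_set" for t p
    using continuous_map_image_subset_topspace[OF cont_t[OF that(1)]] that(2) by auto
  define Sep where "Sep t \<sigma> = {c. h (t, Inr (c, \<sigma>)) \<in> wedge \<sigma> c \<inter> range Inl \<and> h (t, Inr (c, - \<sigma>)) \<in> wedge (- \<sigma>) c}"
    for t \<sigma> :: real
  have "{c. k (Inr (c, 1)) \<notin> range (\<lambda>u. Inr (c, u))} \<subseteq> (\<Union>t\<in>\<rat> \<inter> {0..1}. \<Union>\<sigma>\<in>{1, -1}. Sep t \<sigma>)"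
  proof (intro subsetI)
    fix c
    assume c: "c \<in> {c. k (Inr (c, 1)) \<notin> range (\<lambda>u. Inr (c, u))}"
    define Side :: "real \<Rightarrow> pruefer_point set" where "Side \<sigma> = Inr ` ({c} \<times> {u. 0 < \<sigma> * u})" for \<sigma>
    \<comment> \<open>Times at which some point has left its half line, and times at which both are in their wedges:
      these open sets cover the connected interval, so they overlap.\<close>
    define A where "A = {t \<in> {0..1}. \<exists>\<sigma>\<in>{1, -1}. h (t, Inr (c, \<sigma>)) \<notin> Side \<sigma>}"
    define G where "G = {t \<in> {0..1}. \<forall>\<sigma>\<in>{1, -1}. h (t, Inr (c, \<sigma>)) \<in> wedge \<sigma> c}"
    have openin_preimage: "openin (top_of_set {0..1}) {t \<in> {0..1}. h (t, Inr (c, \<sigma>)) \<in> U}"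
      if "openin pruefer U" "U \<subseteq> punctured_set" "\<sigma> \<in> {1, -1}" for U \<sigma>
    proof -
      have "Inr (c, \<sigma>) \<in> punctured_set" "openin punctured U"
        using that openin_punctured_set by (auto simp: openin_open_subtopology)
      then show ?thesis
        using openin_continuous_map_preimage[OF cont_p] by fastforce
    qed
    have "openin (top_of_set {0..1}) G"
    proof -
      have "G = {t \<in> {0..1}. h (t, Inr (c, 1)) \<in> wedge 1 c} \<inter> {t \<in> {0..1}. h (t, Inr (c, -1)) \<in> wedge (-1) c}"
        by (auto simp: G_def)
      then show ?thesis
        using openin_preimage openin_wedge wedge_subset_punctured_set by (simp add: openin_Int)
    qed
    moreover have "openin (top_of_set {0..1}) A"
    proof -
      have "openin (top_of_set {0..1}) {t \<in> {0..1}. h (t, Inr (c, \<sigma>)) \<in> punctured_set - Side \<sigma>}"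
        if "\<sigma> \<in> {1, -1}" for \<sigma>
      proof -
        have eq: "punctured_set - Side \<sigma> = half_plane_with_boundary {(d, u). u \<noteq> 0 \<and> (d = c \<longrightarrow> \<sigma> * u < 0)}"
          unfolding punctured_set_eq half_plane_with_boundary_def Side_def using that by (auto simp: image_iff)
        have "open {u::real. u \<noteq> 0 \<and> (d = c \<longrightarrow> \<sigma> * u < 0)}" for d
          by (intro open_Collect_conj open_Collect_neq open_Collect_imp open_Collect_less continuous_intros) auto
        then have "openin pruefer (punctured_set - Side \<sigma>)"
          unfolding eq by (intro openin_half_plane_with_boundary) simp
        from openin_preimage[OF this Diff_subset that] show ?thesis .
      qed
      moreover have "A = {t \<in> {0..1}. h (t, Inr (c, 1)) \<in> punctured_set - Side 1} \<union>
          {t \<in> {0..1}. h (t, Inr (c, -1)) \<in> punctured_set - Side (-1)}"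
        using h_in by (auto simp: A_def)
      ultimately show ?thesis
        by (simp only: insert_iff openin_Un simp_thms)
    qed
    moreover have "A \<union> G = {0..1}"
      by (auto simp: A_def G_def Side_def in_wedge)
    moreover have "0 \<in> G"
      by (simp add: G_def h0 in_wedge)
    moreover have "1 \<in> A"
      using c by (auto simp: A_def h1 Side_def)
    ultimately have "A \<inter> G \<noteq> {}" "openin (top_of_set {0..1}) (A \<inter> G)"
      using connected_openin_eq[of "{0..1::real}"] by auto
    then obtain V where V: "open V" "A \<inter> G = {0..1} \<inter> V"
      by (auto simp: openin_open)
    obtain t0 where t0: "t0 \<in> {0..1} \<inter> V"
      using \<open>A \<inter> G \<noteq> {}\<close> V(2) by blast
    have "\<exists>t\<in>\<rat>. t \<in> A \<inter> G"
    proof -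
      obtain e where e: "0 < e" "ball t0 e \<subseteq> V"
        using V(1) t0 open_contains_ball by blast
      have "max 0 (t0 - e) < min 1 (t0 + e)"
        using t0 e(1) by auto
      then obtain t where t: "t \<in> \<rat>" "max 0 (t0 - e) < t" "t < min 1 (t0 + e)"
        using Rats_dense_in_real by blast
      then have "t \<in> ball t0 e"
        by (auto simp: dist_real_def)
      then show ?thesis
        using t V(2) e(2) by (intro bexI[of _ t]) auto
    qed
    then obtain t where t: "t \<in> \<rat>" "t \<in> A" "t \<in> G"
      by blast
    then obtain \<sigma> where \<sigma>: "\<sigma> \<in> {1, -1}" "h (t, Inr (c, \<sigma>)) \<notin> Side \<sigma>"
      by (auto simp: A_def)
    have wedges: "h (t, Inr (c, \<sigma>)) \<in> wedge \<sigma> c" "h (t, Inr (c, - \<sigma>)) \<in> wedge (- \<sigma>) c"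
      using t(3) \<sigma>(1) by (auto simp: G_def)
    moreover have "h (t, Inr (c, \<sigma>)) \<in> range Inl"
      using wedges(1) \<sigma>(2) by (cases "h (t, Inr (c, \<sigma>))") (auto simp: Side_def in_wedge)
    ultimately have "c \<in> Sep t \<sigma>"
      by (simp add: Sep_def)
    then show "c \<in> (\<Union>t\<in>\<rat> \<inter> {0..1}. \<Union>\<sigma>\<in>{1, -1}. Sep t \<sigma>)"
      using t \<sigma>(1) by (auto simp: A_def)
  qed
  moreover have "countable (Sep t \<sigma>)" if "t \<in> {0..1}" "\<sigma> \<in> {1, -1}" for t \<sigma>
    unfolding Sep_def using that by (intro countable_separated_pairs[OF cont_t]) auto
  then have "countable (\<Union>t\<in>\<rat> \<inter> {0..1}. \<Union>\<sigma>\<in>{1, -1}. Sep t \<sigma>)"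
    by (intro countable_UN) (auto simp: countable_rat)
  ultimately show ?thesis
    using countable_subset by blast
qed

text \<open>The images of the charts are open, and each contains only one line.\<close>

lemma compactin_meets_finitely_many_lines:
  assumes "compactin punctured C"
  shows "finite {c. \<exists>u. Inr (c, u) \<in> C}"
proof -
  let ?U = "\<lambda>c. chart c ` (UNIV \<times> {0..})"
  have "compactin pruefer C"
    using assms compactin_subtopology by blast
  moreover have "C \<subseteq> \<Union>(range ?U)"
    using compactin_subset_topspace[OF \<open>compactin pruefer C\<close>] pruefer_set_charts
    by (fastforce simp: topspace_pruefer)
  ultimately obtain \<F> where "finite \<F>" "\<F> \<subseteq> range ?U" "C \<subseteq> \<Union>\<F>"
    using openin_chart_Times[OF open_UNIV] unfolding compactin_def by (metis (no_types, lifting) imageE)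
  moreover from this obtain I where "finite I" "\<F> = ?U ` I"
    using finite_subset_image[of \<F> ?U UNIV] by auto
  ultimately have "finite I" "C \<subseteq> \<Union>(?U ` I)"
    by simp_all
  have "c \<in> I" if cu: "Inr (c, u) \<in> C" for c u
  proof -
    obtain i where "i \<in> I" "Inr (c, u) \<in> ?U i"
      using cu \<open>C \<subseteq> \<Union>(?U ` I)\<close> by blast
    then show ?thesis
      by (simp add: in_chart_image)
  qed
  then have "{c. \<exists>u. Inr (c, u) \<in> C} \<subseteq> I"
    by blast
  then show ?thesis
    using \<open>finite I\<close> finite_subset by blast
qed

lemma id_not_homotopic_into_sigma_compact:
  assumes hom: "homotopic_with (\<lambda>h. True) punctured punctured id k"
    and \<C>: "countable \<C>" "\<And>C. C \<in> \<C> \<Longrightarrow> compactin punctured C"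
  shows "\<not> k ` punctured_set \<subseteq> \<Union>\<C>"
proof
  assume sub: "k ` punctured_set \<subseteq> \<Union>\<C>"
  let ?L = "{c. k (Inr (c, 1)) \<notin> range (\<lambda>u. Inr (c, u))}"
  have "c \<in> ?L \<union> (\<Union>C\<in>\<C>. {c. \<exists>u. Inr (c, u) \<in> C})" for c
  proof -
    have "k (Inr (c, 1)) \<in> \<Union>\<C>"
      using sub by (rule subsetD) (intro imageI, simp)
    then have "c \<in> (\<Union>C\<in>\<C>. {c. \<exists>u. Inr (c, u) \<in> C})" if "k (Inr (c, 1)) = Inr (c, u)" for u
      unfolding that by blast
    then show ?thesis
      by blast
  qed
  then have "(UNIV :: real set) = ?L \<union> (\<Union>C\<in>\<C>. {c. \<exists>u. Inr (c, u) \<in> C})"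
    by (rule UNIV_eq_I)
  moreover have "countable (?L \<union> (\<Union>C\<in>\<C>. {c. \<exists>u. Inr (c, u) \<in> C}))"
    using homotopic_id_leaves_countably_many_lines[OF hom] \<C> compactin_meets_finitely_many_lines
    by (intro countable_Un countable_UN) (auto intro: countable_finite)
  ultimately show False
    using uncountable_UNIV_real by metis
qed

lemma not_contractible_punctured: "\<not> contractible_space punctured"
proof
  assume "contractible_space punctured"
  then obtain a where a: "homotopic_with (\<lambda>h. True) punctured punctured id (\<lambda>_. a)"
    by (auto simp: contractible_space_def)
  have "Inr (0, 1) \<in> topspace punctured"
    by simp
  moreover have "continuous_map punctured punctured (\<lambda>_. a)"
    using homotopic_with_imp_continuous_maps[OF a] by simp
  note continuous_map_image_subset_topspace[OF this]
  ultimately have "a \<in> topspace punctured"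
    by (metis imageI subsetD)
  then show False
    using id_not_homotopic_into_sigma_compact[OF a, of "{{a}}"] by auto
qed

section \<open>Closures of countable sets in CW complexes\<close>

text \<open>The disc is closed in the product topology and contained in a product of compact intervals.\<close>

lemma compact_space_unit_disc: "compact_space (unit_disc n)"
proof -
  let ?C = "PiE UNIV (\<lambda>_. {-1..1}) :: (nat \<Rightarrow> real) set"
  let ?S = "{x. \<forall>i\<ge>n. x i = 0} \<inter> {x. (\<Sum>i<n. (x i)\<^sup>2) \<le> 1} :: (nat \<Rightarrow> real) set"
  have top: "unit_disc n = top_of_set ?S"
    by (simp add: unit_disc_def Euclidean_space_def subtopology_subtopology euclidean_product_topology)
  have "compactin (product_topology (\<lambda>_. euclidean) UNIV) ?C"
    by (simp add: compactin_PiE)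
  then have "compact ?C"
    by (simp add: euclidean_product_topology)
  moreover have "closed ?S"
  proof (intro closed_Int)
    have "{x :: nat \<Rightarrow> real. \<forall>i\<ge>n. x i = 0} = (\<Inter>i\<in>{n..}. {x. x i = 0})"
      by auto
    also have "closed \<dots>"
      by (intro closed_INT ballI closed_Collect_eq continuous_on_const continuous_on_product_coordinates)
    finally show "closed {x :: nat \<Rightarrow> real. \<forall>i\<ge>n. x i = 0}" .
    show "closed {x :: nat \<Rightarrow> real. (\<Sum>i<n. (x i)\<^sup>2) \<le> 1}"
      by (intro closed_Collect_le continuous_on_sum continuous_on_power continuous_on_product_coordinates continuous_on_const)
  qed
  moreover have "?C \<inter> ?S = ?S"
  proof (rule inf_absorb2, rule subsetI)
    fix x :: "nat \<Rightarrow> real"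
    assume x: "x \<in> ?S"
    have "(x i)\<^sup>2 \<le> 1" for i
    proof (cases "i < n")
      case True
      have "(x i)\<^sup>2 \<le> (\<Sum>i<n. (x i)\<^sup>2)"
        using True by (intro member_le_sum) auto
      then show ?thesis
        using x by simp
    qed (use x in auto)
    then have "\<bar>x i\<bar> \<le> 1" for i
      by (simp add: abs_square_le_1)
    then show "x \<in> ?C"
      by (auto simp: abs_le_iff minus_le_iff)
  qed
  ultimately have "compact ?S"
    using compact_Int_closed[of ?C ?S] by simp
  then show ?thesis
    by (simp add: top compact_space_subtopology)
qed

lemma topspace_unit_disc: "topspace (unit_disc n) = topspace (open_unit_disc n) \<union> unit_disc_sphere n"
  by (auto simp: unit_disc_def open_unit_disc_def unit_disc_sphere_def)

text \<open>By closure finiteness, every set \<open>\<E>\<close> of cells can be enlarged by finitely many cells for each of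
its members so as to cover their boundaries. Iterating this from countably many cells that cover
\<open>D\<close> yields a countable set of cells whose union contains the closures of its members. Such a union is
closed by the weak topology, so it contains the closure of \<open>D\<close>.\<close>

lemma CW_closure_of_countable:
  assumes CW: "CW_complex Y" and D: "countable D" "D \<subseteq> topspace Y"
  obtains \<C> where "countable \<C>" "\<forall>C\<in>\<C>. compactin Y C" "Y closure_of D \<subseteq> \<Union>\<C>"
proof -
  have Haus: "Hausdorff_space Y"
    using CW by (simp add: CW_complex_def)
  obtain E d \<Phi> where cells: "cell_decomposition Y E d \<Phi>"
    using CW by (auto simp: CW_complex_def)
  have Un: "\<Union>E = topspace Y" and disj: "pairwise disjnt E"
    using cells by (simp_all add: cell_decomposition_def)
  have cont: "continuous_map (unit_disc (d e)) Y (\<Phi> e)"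
    and homeo: "homeomorphic_map (open_unit_disc (d e)) (subtopology Y e) (\<Phi> e)"
    and fin: "\<exists>F. finite F \<and> F \<subseteq> {f \<in> E. d f < d e} \<and> \<Phi> e ` unit_disc_sphere (d e) \<subseteq> \<Union>F"
    if "e \<in> E" for e
    using cells that by (simp_all add: cell_decomposition_def)
  have weak: "closedin Y A"
    if "A \<subseteq> topspace Y" "\<And>e. e \<in> E \<Longrightarrow> closedin Y (A \<inter> Y closure_of e)" for A
  proof -
    have "\<forall>A \<subseteq> topspace Y. (\<forall>e\<in>E. closedin Y (A \<inter> Y closure_of e)) \<longrightarrow> closedin Y A"
      using cells unfolding cell_decomposition_def by (elim conjE)
    then show ?thesis
      using that by (elim allE[of _ A]) simp
  qed
  define K where "K e = \<Phi> e ` topspace (unit_disc (d e))" for e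
  obtain F where F: "\<And>e. e \<in> E \<Longrightarrow> finite (F e) \<and> F e \<subseteq> E \<and> \<Phi> e ` unit_disc_sphere (d e) \<subseteq> \<Union>(F e)"
  proof -
    have "\<forall>e\<in>E. \<exists>F. finite F \<and> F \<subseteq> E \<and> \<Phi> e ` unit_disc_sphere (d e) \<subseteq> \<Union>F"
    proof
      fix e
      assume "e \<in> E"
      from fin[OF this] obtain F where "finite F" "F \<subseteq> {f \<in> E. d f < d e}" "\<Phi> e ` unit_disc_sphere (d e) \<subseteq> \<Union>F"
        by (elim exE conjE)
      then show "\<exists>F. finite F \<and> F \<subseteq> E \<and> \<Phi> e ` unit_disc_sphere (d e) \<subseteq> \<Union>F"
        by (intro exI[of _ F]) auto
    qed
    from bchoice[OF this] obtain F where "\<forall>e\<in>E. finite (F e) \<and> F e \<subseteq> E \<and> \<Phi> e ` unit_disc_sphere (d e) \<subseteq> \<Union>(F e)"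
      by (elim exE)
    then show thesis
      by (intro that[of F]) (rule bspec)
  qed
  have image_open: "\<Phi> e ` topspace (open_unit_disc (d e)) = e" if "e \<in> E" for e
    using homeomorphic_imp_surjective_map[OF homeo[OF that]] that Un by auto
  have K_eq: "K e = e \<union> \<Phi> e ` unit_disc_sphere (d e)" if "e \<in> E" for e
    by (simp add: K_def topspace_unit_disc image_Un image_open[OF that])
  have K_sub: "K e \<subseteq> e \<union> \<Union>(F e)" if "e \<in> E" for e
    unfolding K_eq[OF that] using F[OF that] by (intro Un_mono) simp_all
  have e_sub: "e \<subseteq> K e" if "e \<in> E" for e
    unfolding K_eq[OF that] by simp
  have compact_K: "compactin Y (K e)" if "e \<in> E" for e
    unfolding K_def using image_compactin[OF _ cont[OF that]] compact_space_unit_disc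
    by (simp add: compact_space_def)
  have closure_sub: "Y closure_of e \<subseteq> K e" if "e \<in> E" for e
    using closure_of_minimal[OF e_sub compactin_imp_closedin[OF Haus compact_K]] that by blast

  have "\<forall>p\<in>D. \<exists>e. e \<in> E \<and> p \<in> e"
    using D(2) Un by blast
  from bchoice[OF this] obtain cell where cell: "\<forall>p\<in>D. cell p \<in> E \<and> p \<in> cell p"
    by (elim exE)
  define G where "G n = ((\<lambda>\<E>. \<Union>(F ` \<E>)) ^^ n) (cell ` D)" for n
  have G: "countable (G n) \<and> G n \<subseteq> E" for n
  proof (induction n)
    case (Suc n)
    have "countable (\<Union>(F ` G n))"
      by (rule countable_UN) (use Suc F in \<open>auto intro: countable_finite\<close>)
    moreover have "\<Union>(F ` G n) \<subseteq> E"
      using Suc F by blast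
    ultimately show ?case
      by (simp add: G_def)
  qed (use D cell in \<open>auto simp: G_def\<close>)
  define E' where "E' = (\<Union>n. G n)"
  have E'_sub: "E' \<subseteq> E" and E'_countable: "countable E'"
    using G by (auto simp: E'_def)
  have F_E': "F e \<subseteq> E'" if "e \<in> E'" for e
  proof -
    obtain n where "e \<in> G n"
      using \<open>e \<in> E'\<close> by (auto simp: E'_def)
    then have "F e \<subseteq> G (Suc n)"
      by (auto simp: G_def)
    then show ?thesis
      by (auto simp: E'_def)
  qed
  have K_E': "K e \<subseteq> \<Union>E'" if "e \<in> E'" for e
    using K_sub[of e] F_E'[OF that] that E'_sub by blast

  have "closedin Y (\<Union>E')"
  proof (rule weak)
    show "\<Union>E' \<subseteq> topspace Y"
      using Un E'_sub by blast
    fix e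
    assume e: "e \<in> E"
    let ?N = "E' \<inter> insert e (F e)"
    \<comment> \<open>The closure of \<open>e\<close> meets \<open>e\<close> and the finitely many cells of \<open>F e\<close> only, so a finite union of
      closed sets remains.\<close>
    have "\<Union>E' \<inter> Y closure_of e = (\<Union>e'\<in>?N. Y closure_of e') \<inter> Y closure_of e"
    proof (intro equalityI subsetI)
      fix p
      assume p: "p \<in> \<Union>E' \<inter> Y closure_of e"
      then obtain e1 where e1: "e1 \<in> E'" "p \<in> e1"
        by blast
      have "p \<in> e \<union> \<Union>(F e)"
        using p closure_sub[OF e] K_sub[OF e] by blast
      then obtain e2 where e2: "e2 \<in> insert e (F e)" "p \<in> e2"
        by blast
      have "e2 \<in> E"
        using e2 F[OF e] e by blast
      then have "e1 = e2"
        using disj e1 e2 E'_sub by (meson disjnt_iff pairwiseD subsetD)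
      moreover have "p \<in> Y closure_of e1"
        using e1 E'_sub Un closure_of_subset[of e1 Y] by blast
      ultimately show "p \<in> (\<Union>e'\<in>?N. Y closure_of e') \<inter> Y closure_of e"
        using p e1 e2 by blast
    next
      fix p
      assume "p \<in> (\<Union>e'\<in>?N. Y closure_of e') \<inter> Y closure_of e"
      then show "p \<in> \<Union>E' \<inter> Y closure_of e"
        using closure_sub E'_sub K_E' by blast
    qed
    moreover have "closedin Y ((\<Union>e'\<in>?N. Y closure_of e') \<inter> Y closure_of e)"
      using F[OF e] by (intro closedin_Int closedin_Union) auto
    ultimately show "closedin Y (\<Union>E' \<inter> Y closure_of e)"
      by simp
  qed
  moreover have "D \<subseteq> \<Union>E'"
  proof -
    have "cell ` D \<subseteq> E'"
      unfolding E'_def by (rule order_trans[OF _ UN_upper[of 0]]) (auto simp: G_def)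
    then show ?thesis
      using cell by blast
  qed
  ultimately have "Y closure_of D \<subseteq> \<Union>E'"
    by (rule closure_of_minimal[rotated])
  also have "\<dots> \<subseteq> \<Union>(K ` E')"
    using e_sub E'_sub by blast
  finally show thesis
    using that[of "K ` E'"] compact_K E'_sub E'_countable by auto
qed

section \<open>The homotopy type of the punctured surface\<close>

text \<open>Only \<open>g \<circ> f \<simeq> id\<close> is used: the image of \<open>f\<close> lies in the closure of a countable set, hence in a
countable union of compact sets, and \<open>g\<close> maps these to compact sets.\<close>

lemma punctured_not_homotopy_equivalent_CW:
  assumes CW: "CW_complex Y"
  shows "\<not> punctured homotopy_equivalent_space Y"
proof
  assume "punctured homotopy_equivalent_space Y"
  then obtain f g where f: "continuous_map punctured Y f" and g: "continuous_map Y punctured g"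
    and gf: "homotopic_with (\<lambda>h. True) punctured punctured (g \<circ> f) id"
    unfolding homotopy_equivalent_space_def by (elim exE conjE)
  obtain D where D: "countable D" "D \<subseteq> topspace punctured" "punctured closure_of D = topspace punctured"
    using separable_space_open_subset[OF separable_pruefer openin_punctured_set]
    unfolding separable_space_def by blast
  have "countable (f ` D)" "f ` D \<subseteq> topspace Y"
    using D(1) order_trans[OF image_mono[OF D(2)] continuous_map_image_subset_topspace[OF f]] by simp_all
  then obtain \<C> where \<C>: "countable \<C>" "\<forall>C\<in>\<C>. compactin Y C" "Y closure_of (f ` D) \<subseteq> \<Union>\<C>"
    by (rule CW_closure_of_countable[OF CW]) blast
  have "f ` punctured_set \<subseteq> \<Union>\<C>"
    using continuous_map_image_closure_subset[OF f, of D] D(3) \<C>(3) by (simp add: Int_absorb1)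
  then have "(g \<circ> f) ` punctured_set \<subseteq> g ` \<Union>\<C>"
    unfolding image_comp[symmetric] by (rule image_mono)
  then have sub: "(g \<circ> f) ` punctured_set \<subseteq> \<Union>((`) g ` \<C>)"
    by (simp add: image_Union)
  have "countable ((`) g ` \<C>)"
    using \<C>(1) by simp
  moreover have "compactin punctured C" if "C \<in> (`) g ` \<C>" for C
    using that \<C>(2) image_compactin[OF _ g] by auto
  ultimately have "\<not> (g \<circ> f) ` punctured_set \<subseteq> \<Union>((`) g ` \<C>)"
    by (rule id_not_homotopic_into_sigma_compact[OF homotopic_with_symD[OF gf]])
  then show False
    using sub by contradiction
qed

theorem theorem1p7:
  shows "manifold_with_boundary 2 pruefer \<and>
     separable_space pruefer \<and>
     contractible_space pruefer \<and>
     submanifold pruefer (topspace pruefer - pruefer_zeros) \<and>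
     \<not> metrizable_space (subtopology pruefer (topspace pruefer - pruefer_zeros)) \<and>
     \<not> contractible_space (subtopology pruefer (topspace pruefer - pruefer_zeros)) \<and>
     (\<forall>Y :: 'b topology. CW_complex Y \<longrightarrow>
        \<not> (subtopology pruefer (topspace pruefer - pruefer_zeros)) homotopy_equivalent_space Y)"
proof (intro conjI allI impI)
  show "submanifold pruefer punctured_set"
    unfolding submanifold_def using manifold_punctured by blast
  show "\<not> punctured homotopy_equivalent_space Y" if "CW_complex Y" for Y :: "'b topology"
    using that by (rule punctured_not_homotopy_equivalent_CW)
qed (rule manifold_pruefer separable_pruefer contractible_pruefer not_metrizable_punctured
    not_contractible_punctured)+

end
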